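(* Let $H_1$ and $H_2$ be Hilbert spaces and let $(S,T)$ be a Fredholm pair with $S\in L(H_1,H_2)$ and $T\in L(H_2,H_1)$. Let $K\colon H_1\to H_2$ and $K'\colon H_2\to H_1$ be compact operators, and put $S_1=S+K$ and $T_1=T+K'$. Suppose that $R(T_1S_1)$ and $R(S_1T_1)$ are finite dimensional subspaces of $H_1$ and $H_2$ respectively. Then $(S_1,T_1)$ is a Fredholm pair. Furthermore, $\operatorname{ind}(S,T)=\operatorname{ind}(S_1,T_1)$.
   Context: For Hilbert spaces $H_1,H_2$, $L(H_1,H_2)$ denotes the bounded linear maps from $H_1$ to $H_2$. $N(\cdot)$ and $R(\cdot)$ denote null space and range. A pair $(S,T)$ with $S\in L(H_1,H_2)$, $T\in L(H_2,H_1)$ is called a Fredholm pair if the following dimensions are all finite: $a=\dim N(S)/(N(S)\cap R(T))$, $b=\dim R(T)/(N(S)\cap R(T))$, $c=\dim N(T)/(N(T)\cap R(S))$, $d=\dim R(S)/(N(T)\cap R(S))$. The index of a Fredholm pair is $\operatorname{ind}(S,T)=a-b-c+d$. *)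

theory Defs
  imports "HOL-Analysis.Analysis" "HOL-Library.Set_Algebras" "HOL-Library.FuncSet"
begin

text \<open>The scalar field of a Hilbert space is the real or the complex numbers. The following
class has, up to isomorphism, exactly these two models, with complex conjugation resp. the
identity as conjugation.\<close>

class rc_field = real_normed_field +
  fixes rc_conj :: "'a \<Rightarrow> 'a"
  assumes rc_conj_add: "rc_conj (x + y) = rc_conj x + rc_conj y"
    and rc_conj_mult: "rc_conj (x * y) = rc_conj x * rc_conj y"
    and rc_conj_conj: "rc_conj (rc_conj x) = x"
    and mult_rc_conj: "x * rc_conj x = scaleR ((norm x)\<^sup>2) 1"
    and two_generators: "\<exists>i. \<forall>x. \<exists>a b. x = scaleR a 1 + scaleR b i"

instantiation real :: rc_field
begin
definition rc_conj_real :: "real \<Rightarrow> real" where "rc_conj_real x = x"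
instance
  by standard (auto simp: rc_conj_real_def power2_eq_square intro: exI[of _ 0])
end

instantiation complex :: rc_field
begin
definition rc_conj_complex :: "complex \<Rightarrow> complex" where "rc_conj_complex = cnj"
instance
proof
  show "\<exists>i::complex. \<forall>x. \<exists>a b. x = a *\<^sub>R 1 + b *\<^sub>R i"
  proof (rule exI[of _ \<i>], rule allI)
    fix x :: complex
    have "x = Re x *\<^sub>R 1 + Im x *\<^sub>R \<i>" by (simp add: complex_eq_iff)
    then show "\<exists>a b. x = a *\<^sub>R 1 + b *\<^sub>R \<i>" by blast
  qed
qed (simp_all add: rc_conj_complex_def complex_norm_square scaleR_conv_of_real del: of_real_power)
end

text \<open>A Hilbert space over the scalar field \<open>'k\<close>. Since the norm is the one induced by \<open>ip\<close>,
the inner product of the class \<open>real_inner\<close> is necessarily the real part of \<open>ip\<close>, so this class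
constraint adds no structure beyond that of a Hilbert space.\<close>

locale hilbert_space = vector_space scale
  for scale :: "'k::rc_field \<Rightarrow> 'a::{real_inner, complete_space} \<Rightarrow> 'a" +
  fixes ip :: "'a \<Rightarrow> 'a \<Rightarrow> 'k"
  assumes scale_of_real: "scale (of_real r) x = r *\<^sub>R x"
    and ip_add_left: "ip (x + y) z = ip x z + ip y z"
    and ip_scale_left: "ip (scale c x) y = c * ip x y"
    and ip_commute: "ip y x = rc_conj (ip x y)"
    and ip_self: "ip x x = of_real ((norm x)\<^sup>2)"

lemma hilbert_space_real:
  "hilbert_space (scaleR :: real \<Rightarrow> 'a::{real_inner, complete_space} \<Rightarrow> 'a) inner"
  by unfold_locales
    (auto simp: algebra_simps inner_commute rc_conj_real_def power2_norm_eq_inner)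

lemma hilbert_space_complex: "hilbert_space (*) (\<lambda>x y :: complex. x * cnj y)"
  by unfold_locales
    (simp_all add: algebra_simps rc_conj_complex_def scaleR_conv_of_real complex_norm_square
      del: of_real_power)

definition bounded_operators ::
    "('k::rc_field \<Rightarrow> 'a::real_normed_vector \<Rightarrow> 'a) \<Rightarrow> ('k \<Rightarrow> 'b::real_normed_vector \<Rightarrow> 'b)
      \<Rightarrow> ('a \<Rightarrow> 'b) set" where
  "bounded_operators s1 s2 = {f. Vector_Spaces.linear s1 s2 f \<and> bounded_linear f}"

definition compact_operator ::
    "('k::rc_field \<Rightarrow> 'a::real_normed_vector \<Rightarrow> 'a) \<Rightarrow> ('k \<Rightarrow> 'b::real_normed_vector \<Rightarrow> 'b)
      \<Rightarrow> ('a \<Rightarrow> 'b) \<Rightarrow> bool" where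
  "compact_operator s1 s2 f \<longleftrightarrow>
     Vector_Spaces.linear s1 s2 f \<and> (\<forall>A. bounded A \<longrightarrow> compact (closure (f ` A)))"

definition null_space :: "('a \<Rightarrow> 'b::zero) \<Rightarrow> 'a set" where
  "null_space f = {x. f x = 0}"

definition finite_dimensional ::
    "('k::field \<Rightarrow> 'a::ab_group_add \<Rightarrow> 'a) \<Rightarrow> 'a set \<Rightarrow> bool" where
  "finite_dimensional s V \<longleftrightarrow> (\<exists>B. finite B \<and> module.span s B = V)"

text \<open>For subspaces \<open>W \<subseteq> V\<close>, the vectors in \<open>B\<close> represent a finite basis of the quotient space
\<open>V / W\<close>: every coset \<open>v + W\<close> is, with unique coefficients, a linear combination of the cosets
\<open>b + W\<close> with \<open>b \<in> B\<close>. Uniqueness forces distinct elements of \<open>B\<close> to have distinct cosets, so the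
basis has \<open>card B\<close> elements.\<close>

definition quotient_basis ::
    "('k::field \<Rightarrow> 'a::ab_group_add \<Rightarrow> 'a) \<Rightarrow> 'a set \<Rightarrow> 'a set \<Rightarrow> 'a set \<Rightarrow> bool" where
  "quotient_basis s V W B \<longleftrightarrow>
     finite B \<and> B \<subseteq> V \<and>
     (\<forall>v\<in>V. \<exists>!c. c \<in> extensional B \<and> v +o W = (\<Sum>b\<in>B. s (c b) b) +o W)"

definition quotient_finite_dim ::
    "('k::field \<Rightarrow> 'a::ab_group_add \<Rightarrow> 'a) \<Rightarrow> 'a set \<Rightarrow> 'a set \<Rightarrow> bool" where
  "quotient_finite_dim s V W \<longleftrightarrow> (\<exists>B. quotient_basis s V W B)"

text \<open>Only meaningful if the quotient is finite-dimensional.\<close>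

definition quotient_dim ::
    "('k::field \<Rightarrow> 'a::ab_group_add \<Rightarrow> 'a) \<Rightarrow> 'a set \<Rightarrow> 'a set \<Rightarrow> nat" where
  "quotient_dim s V W = card (SOME B. quotient_basis s V W B)"

definition fredholm_pair ::
    "('k::rc_field \<Rightarrow> 'a::real_normed_vector \<Rightarrow> 'a) \<Rightarrow> ('k \<Rightarrow> 'b::real_normed_vector \<Rightarrow> 'b)
      \<Rightarrow> ('a \<Rightarrow> 'b) \<Rightarrow> ('b \<Rightarrow> 'a) \<Rightarrow> bool" where
  "fredholm_pair s1 s2 S T \<longleftrightarrow>
     S \<in> bounded_operators s1 s2 \<and> T \<in> bounded_operators s2 s1 \<and>
     quotient_finite_dim s1 (null_space S) (null_space S \<inter> range T) \<and>
     quotient_finite_dim s1 (range T) (null_space S \<inter> range T) \<and>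
     quotient_finite_dim s2 (null_space T) (null_space T \<inter> range S) \<and>
     quotient_finite_dim s2 (range S) (null_space T \<inter> range S)"

definition fredholm_index ::
    "('k::rc_field \<Rightarrow> 'a::real_normed_vector \<Rightarrow> 'a) \<Rightarrow> ('k \<Rightarrow> 'b::real_normed_vector \<Rightarrow> 'b)
      \<Rightarrow> ('a \<Rightarrow> 'b) \<Rightarrow> ('b \<Rightarrow> 'a) \<Rightarrow> int" where
  "fredholm_index s1 s2 S T =
     int (quotient_dim s1 (null_space S) (null_space S \<inter> range T))
     - int (quotient_dim s1 (range T) (null_space S \<inter> range T))
     - int (quotient_dim s2 (null_space T) (null_space T \<inter> range S))
     + int (quotient_dim s2 (range S) (null_space T \<inter> range S))"

end

theory Submission
  imports Defs
begin

text \<open>Call two subspaces \<open>V\<close> and \<open>W\<close> commensurable if \<open>V \<inter> W\<close> has finite codimension in both, and let their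
relative dimension be \<open>dim V/(V \<inter> W) - dim W/(V \<inter> W)\<close>. A pair \<open>(S, T)\<close> is Fredholm exactly if
\<open>N(S)\<close> is commensurable with \<open>R(T)\<close> and \<open>N(T)\<close> with \<open>R(S)\<close>, and its index is the difference of these
two relative dimensions. Relative dimension is additive (\<open>commensurable_trans\<close>), and by rank-nullity the
changes of kernel and of range cancel when a linear map is altered by one of finite rank
(\<open>relative_dim_kernel_plus_range\<close>). So a finite rank change of \<open>S\<close> or \<open>T\<close> changes neither the
Fredholm property nor the index (\<open>commensurable_pair_cong\<close>); this is pure linear algebra. A single
Fredholm operator \<open>V\<close> is the pair \<open>(V, 0)\<close>, so the same statement covers it.

The analysis enters through the operator \<open>S + T\<^sup>*\<close>, where \<open>T\<^sup>*\<close> is the Hilbert space adjoint. If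
\<open>ST = 0\<close> and \<open>TS = 0\<close>, then the ranges of \<open>S\<close> and \<open>T\<^sup>*\<close> are orthogonal, and \<open>(S, T)\<close> is Fredholm iff
\<open>S + T\<^sup>*\<close> and \<open>T + S\<^sup>*\<close> are Fredholm operators; the index of the pair is that of \<open>S + T\<^sup>*\<close>
(\<open>square_zero_pair_fredholm\<close>, \<open>square_zero_pair_commensurable\<close>). A pair whose two products have finite
rank acquires zero products by a finite rank change (\<open>square_zero_correction\<close>). This applies to
\<open>(S, T)\<close>, because it is Fredholm, and to \<open>(S\<^sub>1, T\<^sub>1)\<close>, by hypothesis. The two resulting operators of the form
\<open>S + T\<^sup>*\<close> differ by a compact operator, that is by a finite rank operator plus an operator of
arbitrarily small norm (\<open>compact_finite_rank_approx\<close>). Finite rank is dealt with above, and the small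
part does no harm because a Fredholm operator keeps its index under small perturbations
(\<open>fredholm_small_perturbation\<close>).

The adjoint is taken for the real inner product, so all this is done over the reals. A quotient of
subspaces over the scalar field has finite dimension over it iff it has over the reals, and the two
dimensions differ by the factor \<open>m\<close>, the real dimension of the field. Hence the real index is \<open>m\<close>
times the index, and the factor \<open>m > 0\<close> cancels.\<close>

section \<open>Finite extensions of subspaces\<close>

definition adjoin :: "('k::field \<Rightarrow> 'a::ab_group_add \<Rightarrow> 'a) \<Rightarrow> 'a set \<Rightarrow> 'a \<Rightarrow> 'a set" where
  "adjoin s V b = {v + s c b | v c. v \<in> V}"

text \<open>Codimension is encoded by a chain that adjoins one vector at a time. This makes statements about the
behaviour of codimension under intersection, sum, image and preimage provable by induction along the
chain, with one comparison of dimensions 0 and 1 in each step, and without choosing bases.\<close>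

inductive finite_ext ::
  "('k::field \<Rightarrow> 'a::ab_group_add \<Rightarrow> 'a) \<Rightarrow> 'a set \<Rightarrow> 'a set \<Rightarrow> nat \<Rightarrow> bool" for s W where
  refl: "finite_ext s W W 0"
| step: "finite_ext s W V n \<Longrightarrow> b \<notin> V \<Longrightarrow> finite_ext s W (adjoin s V b) (Suc n)"

lemma finite_ext_trans:
  assumes "finite_ext s V X n" "finite_ext s W V m"
  shows "finite_ext s W X (m + n)"
  using assms by (induction) (auto intro: finite_ext.intros)

lemma finite_ext_0: "finite_ext s W V 0 \<longleftrightarrow> V = W"
  by (auto elim: finite_ext.cases intro: finite_ext.refl)

text \<open>A basis of \<open>V\<close> modulo \<open>W\<close>, with spanning and independence as separate clauses. In this form a basis can be built up
along a chain of adjoined vectors; the definition of a quotient basis by unique coefficients of cosets is equivalent.\<close>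

definition relative_basis ::
  "('k::field \<Rightarrow> 'a::ab_group_add \<Rightarrow> 'a) \<Rightarrow> 'a set \<Rightarrow> 'a set \<Rightarrow> 'a set \<Rightarrow> bool" where
  "relative_basis s W V B \<longleftrightarrow> finite B \<and> V = {w + (\<Sum>b\<in>B. s (c b) b) | w c. w \<in> W} \<and>
     (\<forall>c. (\<Sum>b\<in>B. s (c b) b) \<in> W \<longrightarrow> (\<forall>b\<in>B. c b = 0))"

context vector_space
begin

lemma adjoin_superset: "V \<subseteq> adjoin scale V b"
proof
  fix v assume "v \<in> V"
  then have "v = v + scale 0 b \<and> v \<in> V" by simp
  then show "v \<in> adjoin scale V b" unfolding adjoin_def by blast
qed

lemma adjoin_mem: assumes "subspace V" shows "b \<in> adjoin scale V b"
proof -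
  have "b = 0 + scale 1 b \<and> 0 \<in> V" using subspace_0[OF assms] by simp
  then show ?thesis unfolding adjoin_def by blast
qed

lemma subspace_adjoin: assumes "subspace V" shows "subspace (adjoin scale V b)"
proof (rule subspaceI)
  show "0 \<in> adjoin scale V b" using adjoin_superset subspace_0[OF assms] by blast
next
  fix x y assume "x \<in> adjoin scale V b" "y \<in> adjoin scale V b"
  then obtain v c w d where "x = v + scale c b" "v \<in> V" "y = w + scale d b" "w \<in> V"
    unfolding adjoin_def by blast
  then have "x + y = (v + w) + scale (c + d) b \<and> v + w \<in> V"
    using subspace_add[OF assms] by (simp add: scale_left_distrib)
  then show "x + y \<in> adjoin scale V b" unfolding adjoin_def by blast
next
  fix a x assume "x \<in> adjoin scale V b"
  then obtain v c where "x = v + scale c b" "v \<in> V" unfolding adjoin_def by blast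
  then have "scale a x = scale a v + scale (a * c) b \<and> scale a v \<in> V"
    using subspace_scale[OF assms] by (simp add: scale_right_distrib)
  then show "scale a x \<in> adjoin scale V b" unfolding adjoin_def by blast
qed

lemma adjoin_subset: "subspace X \<Longrightarrow> V \<subseteq> X \<Longrightarrow> b \<in> X \<Longrightarrow> adjoin scale V b \<subseteq> X"
  unfolding adjoin_def by (auto intro!: subspace_add subspace_scale)

text \<open>If \<open>x = v + c b\<close> is not in \<open>V\<close>, then \<open>c\<close> is not 0, and the equation can be solved for \<open>b\<close>.\<close>

lemma adjoin_exchange:
  assumes V: "subspace V" and x: "x \<in> adjoin scale V b" "x \<notin> V"
  shows "adjoin scale V x = adjoin scale V b"
proof
  show "adjoin scale V x \<subseteq> adjoin scale V b"
    using adjoin_subset[OF subspace_adjoin[OF V] adjoin_superset x(1)] .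
  obtain v c where vc: "x = v + scale c b" "v \<in> V" using x(1) unfolding adjoin_def by blast
  then have "c \<noteq> 0" using x(2) by auto
  then have "b = scale (inverse c) (x - v)" using vc by simp
  moreover have "scale (inverse c) (x - v) \<in> adjoin scale V x"
    using adjoin_superset[of V x] adjoin_mem[OF V, of x] vc(2) subspace_adjoin[OF V, of x]
    by (intro subspace_scale subspace_diff) auto
  ultimately have "b \<in> adjoin scale V x" by simp
  then show "adjoin scale V b \<subseteq> adjoin scale V x"
    using adjoin_subset[OF subspace_adjoin[OF V] adjoin_superset] by blast
qed

lemma finite_ext_subset: "finite_ext scale W V n \<Longrightarrow> W \<subseteq> V"
  by (induction rule: finite_ext.induct) (use adjoin_superset in blast)+

lemma finite_ext_subspace: "finite_ext scale W V n \<Longrightarrow> subspace W \<Longrightarrow> subspace V"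
  by (induction rule: finite_ext.induct) (auto intro: subspace_adjoin)

lemma subspace_set_plus: "subspace V \<Longrightarrow> subspace W \<Longrightarrow> subspace (V + W)"
proof -
  have "V + W = {x + y |x y. x \<in> V \<and> y \<in> W}" unfolding set_plus_def by blast
  then show "subspace V \<Longrightarrow> subspace W \<Longrightarrow> subspace (V + W)" using subspace_sums by simp
qed

lemma set_plus_least: "subspace X \<Longrightarrow> V \<subseteq> X \<Longrightarrow> U \<subseteq> X \<Longrightarrow> V + U \<subseteq> X"
  by (auto elim!: set_plus_elim intro!: subspace_add)

lemma subset_set_plus:
  assumes "subspace V" "subspace U" shows "V \<subseteq> V + U" "U \<subseteq> V + U"
  using set_plus_intro[of _ V 0 U] set_plus_intro[of 0 V _ U] subspace_0[OF assms(1)] subspace_0[OF assms(2)] by auto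

lemma set_plus_absorb: "subspace V \<Longrightarrow> subspace W \<Longrightarrow> W \<subseteq> V \<Longrightarrow> V + W = V"
  by (simp add: subset_antisym set_plus_least subset_set_plus)

lemma adjoin_Int:
  assumes "subspace U" "u \<in> U"
  shows "adjoin scale V u \<inter> U = adjoin scale (V \<inter> U) u"
proof
  show "adjoin scale V u \<inter> U \<subseteq> adjoin scale (V \<inter> U) u"
  proof
    fix x assume x: "x \<in> adjoin scale V u \<inter> U"
    then obtain w c where wc: "x = w + scale c u" "w \<in> V" unfolding adjoin_def by blast
    have "w = x - scale c u" using wc by simp
    then have "w \<in> U" using x assms by (auto intro!: subspace_diff subspace_scale)
    then show "x \<in> adjoin scale (V \<inter> U) u" using wc unfolding adjoin_def by blast
  qed
  show "adjoin scale (V \<inter> U) u \<subseteq> adjoin scale V u \<inter> U"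
    using assms unfolding adjoin_def by (auto intro!: subspace_add subspace_scale)
qed

lemma adjoin_absorb: "subspace V \<Longrightarrow> b \<in> V \<Longrightarrow> adjoin scale V b = V"
  by (simp add: subset_antisym adjoin_subset adjoin_superset)

text \<open>The modular law for codimensions. Each adjoined vector \<open>b\<close> enlarges exactly one of the two chains: if
\<open>b = v + u\<close> with \<open>u \<in> U\<close>, then \<open>b\<close> may be replaced by \<open>u\<close>, which enlarges the intersection with \<open>U\<close> and leaves
the sum alone; otherwise the sum grows and the intersection does not.\<close>

lemma finite_ext_modular:
  assumes "finite_ext scale W V n" and W: "subspace W" and U: "subspace U"
  shows "\<exists>k l. finite_ext scale (W \<inter> U) (V \<inter> U) k \<and> finite_ext scale (W + U) (V + U) l \<and> k + l = n"
  using assms(1)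
proof (induction rule: finite_ext.induct)
  case refl
  then show ?case using finite_ext.refl by fastforce
next
  case (step V n b)
  then obtain k l where kl: "finite_ext scale (W \<inter> U) (V \<inter> U) k" "finite_ext scale (W + U) (V + U) l" "k + l = n"
    by blast
  have V: "subspace V" using finite_ext_subspace[OF step(1) W] .
  let ?V' = "adjoin scale V b"
  have V': "subspace ?V'" using subspace_adjoin[OF V] .
  have bV': "b \<in> ?V'" and VV': "V \<subseteq> ?V'" using adjoin_mem[OF V] adjoin_superset by auto
  have sVU: "subspace (V + U)" and sVU': "subspace (?V' + U)" using subspace_set_plus V V' U by auto
  have sub: "V + U \<subseteq> ?V' + U" using VV' by (rule set_plus_mono2) simp
  have U0: "0 \<in> U" "0 \<in> V" using subspace_0 U V by auto
  have inV: "V \<subseteq> V + U" "U \<subseteq> V + U"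
    using subset_set_plus[OF V U] by auto
  show ?case
  proof (cases "b \<in> V + U")
    case True
    then obtain v u where vu: "b = v + u" "v \<in> V" "u \<in> U" by (rule set_plus_elim)
    have "?V' \<subseteq> V + U" using adjoin_subset[OF sVU inV(1) True] .
    then have eq: "?V' + U = V + U"
      using sub inV(2) by (simp add: subset_antisym set_plus_least[OF sVU])
    have u: "u = b - v" using vu by simp
    have uV': "u \<in> ?V'" unfolding u using bV' vu(2) VV' by (intro subspace_diff[OF V']) auto
    have unV: "u \<notin> V" using step(2) vu subspace_add[OF V] by auto
    have ex: "adjoin scale V u = ?V'" by (rule adjoin_exchange[OF V uV' unV])
    have "finite_ext scale (W \<inter> U) (?V' \<inter> U) (Suc k)"
      using finite_ext.step[OF kl(1), of u] unV adjoin_Int[OF U vu(3), of V] ex by auto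
    then show ?thesis using kl eq by (metis add_Suc)
  next
    case False
    have eq: "?V' \<inter> U = V \<inter> U"
    proof
      show "V \<inter> U \<subseteq> ?V' \<inter> U" using VV' by blast
      show "?V' \<inter> U \<subseteq> V \<inter> U"
      proof
        fix x assume x: "x \<in> ?V' \<inter> U"
        show "x \<in> V \<inter> U"
        proof (rule ccontr)
          assume "x \<notin> V \<inter> U"
          then have "adjoin scale V x = ?V'" using adjoin_exchange[OF V, of x b] x by blast
          then have "b \<in> adjoin scale V x" using bV' by simp
          moreover have "adjoin scale V x \<subseteq> V + U" using adjoin_subset[OF sVU inV(1)] x inV(2) by blast
          ultimately show False using False by blast
        qed
      qed
    qed
    have "?V' + U = adjoin scale (V + U) b"
    proof
      have "?V' \<subseteq> adjoin scale (V + U) b" 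
        using adjoin_subset[OF subspace_adjoin[OF sVU]] inV adjoin_superset[of "V + U" b] adjoin_mem[OF sVU] by blast
      moreover have "U \<subseteq> adjoin scale (V + U) b" using inV adjoin_superset by blast
      ultimately show "?V' + U \<subseteq> adjoin scale (V + U) b"
        by (rule set_plus_least[OF subspace_adjoin[OF sVU]])
      show "adjoin scale (V + U) b \<subseteq> ?V' + U"
        using adjoin_subset[OF sVU' sub] bV' subset_set_plus(1)[OF V' U] by blast
    qed
    then have "finite_ext scale (W + U) (?V' + U) (Suc l)"
      using finite_ext.step[OF kl(2) False] by simp
    then show ?thesis using kl eq by (metis add_Suc_right)
  qed
qed

lemma finite_ext_Int:
  assumes "finite_ext scale W V n" "subspace W" "subspace U"
  shows "\<exists>k. finite_ext scale (W \<inter> U) (V \<inter> U) k"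
  using finite_ext_modular[OF assms] by blast

lemma finite_ext_between:
  assumes "finite_ext scale W X n" "subspace W" "subspace V" "W \<subseteq> V" "V \<subseteq> X"
  shows "\<exists>k l. finite_ext scale W V k \<and> finite_ext scale V X l \<and> k + l = n"
proof -
  have "W \<inter> V = W" "X \<inter> V = V" using assms by auto
  moreover have "W + V = V" "X + V = X"
    using set_plus_absorb[of V W] set_plus_absorb[of X V] finite_ext_subspace[OF assms(1,2)] assms
    by (simp_all add: add.commute[of W V])
  ultimately show ?thesis using finite_ext_modular[OF assms(1-3)] by simp
qed

text \<open>The argument of the Jordan-Hoelder theorem. Two chains from \<open>W\<close> to \<open>V\<close> with different last intermediate spaces
\<open>V'\<close> and \<open>V''\<close> are compared through \<open>V' \<inter> V''\<close>, which by the modular law has codimension 1 in both.\<close>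

lemma finite_ext_unique:
  assumes W: "subspace W"
  shows "finite_ext scale W V n \<Longrightarrow> finite_ext scale W V m \<Longrightarrow> n = m"
proof (induction n arbitrary: V m)
  case 0
  then have VW: "V = W" by (simp add: finite_ext_0)
  show ?case
  proof (rule ccontr)
    assume "0 \<noteq> m"
    with 0(2) obtain V' b n' where "V = adjoin scale V' b" "finite_ext scale W V' n'" "b \<notin> V'"
      by (auto elim: finite_ext.cases)
    then show False
      using VW finite_ext_subset[of W V' n'] adjoin_mem[of V' b] finite_ext_subspace[of W V' n'] W by blast
  qed
next
  case (Suc n)
  from Suc(2) obtain V' b where V': "V = adjoin scale V' b" "finite_ext scale W V' n" "b \<notin> V'"
    by (auto elim: finite_ext.cases)
  have sV': "subspace V'" using finite_ext_subspace[OF V'(2) W] .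
  have "m \<noteq> 0"
  proof
    assume "m = 0"
    then have "V = W" using Suc(3) by (simp add: finite_ext_0)
    then show False using V' finite_ext_subset[OF V'(2)] adjoin_mem[OF sV', of b] by auto
  qed
  with Suc(3) obtain V'' b'' m' where V'': "V = adjoin scale V'' b''" "finite_ext scale W V'' m'" "b'' \<notin> V''" "m = Suc m'"
    by (auto elim: finite_ext.cases)
  have sV'': "subspace V''" using finite_ext_subspace[OF V''(2) W] .
  have max1: "X = V'" if X: "subspace X" "V' \<subseteq> X" "X \<subseteq> V" "X \<noteq> V" for X
  proof (rule ccontr)
    assume "X \<noteq> V'"
    then obtain x where "x \<in> X" "x \<notin> V'" using X by blast
    then have "V \<subseteq> X" using adjoin_exchange[OF sV', of x b] V' X adjoin_subset[of X V' x] by blast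
    then show False using X by blast
  qed
  have max2: "X = V''" if X: "subspace X" "V'' \<subseteq> X" "X \<subseteq> V" "X \<noteq> V" for X
  proof (rule ccontr)
    assume "X \<noteq> V''"
    then obtain x where "x \<in> X" "x \<notin> V''" using X by blast
    then have "V \<subseteq> X" using adjoin_exchange[OF sV'', of x b''] V'' X adjoin_subset[of X V'' x] by blast
    then show False using X by blast
  qed
  have sub: "V' \<subseteq> V" "V'' \<subseteq> V" "V' \<noteq> V" "V'' \<noteq> V"
    using V' V'' adjoin_superset adjoin_mem[OF sV', of b] adjoin_mem[OF sV'', of b''] by auto
  show ?case
  proof (cases "V' = V''")
    case True
    then show ?thesis using Suc(1)[OF V'(2)] V'' by simp
  next
    case False
    let ?I = "V' \<inter> V''"
    have sI: "subspace ?I" using sV' sV'' by (rule subspace_inter)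
    have notsub: "\<not> V' \<subseteq> V''" "\<not> V'' \<subseteq> V'" using max1[OF sV''] max2[OF sV'] sub False by auto
    have one': "finite_ext scale V' V 1" and one'': "finite_ext scale V'' V 1"
      using finite_ext.step[OF finite_ext.refl[of scale V'] V'(3)] finite_ext.step[OF finite_ext.refl[of scale V''] V''(3)]
      V'(1) V''(1) by auto
    have VI: "V \<inter> V'' = V''" "V \<inter> V' = V'" using sub by auto
    have a: "finite_ext scale ?I V'' 1"
    proof -
      obtain k l where kl: "finite_ext scale ?I V'' k" "k + l = 1"
        using finite_ext_modular[OF one' sV' sV''] VI by auto
      have "k \<noteq> 0"
      proof
        assume "k = 0"
        then have "V'' = ?I" using kl(1) by (simp only: finite_ext_0)
        then show False using notsub by blast
      qed
      then have "k = 1" using kl(2) by simp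
      then show ?thesis using kl(1) by simp
    qed
    have b: "finite_ext scale ?I V' 1"
    proof -
      obtain k l where kl: "finite_ext scale ?I V' k" "k + l = 1"
        using finite_ext_modular[OF one'' sV'' sV'] VI by (auto simp: Int_commute)
      have "k \<noteq> 0"
      proof
        assume "k = 0"
        then have "V' = ?I" using kl(1) by (simp only: finite_ext_0)
        then show False using notsub by blast
      qed
      then have "k = 1" using kl(2) by simp
      then show ?thesis using kl(1) by simp
    qed
    obtain k where k: "finite_ext scale W ?I k"
      using finite_ext_between[OF V'(2) W sI] finite_ext_subset[OF V'(2)] finite_ext_subset[OF V''(2)] by blast
    have "n = k + 1" using Suc(1)[OF V'(2)] finite_ext_trans[OF b k] by simp
    then have "finite_ext scale W V'' n" using finite_ext_trans[OF a k] by simp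
    then have "n = m'" using Suc(1) V''(2) by blast
    then show ?thesis using V'' by simp
  qed
qed

section \<open>Bases of quotient spaces\<close>

lemma combination_insert:
  assumes "finite B" "b \<notin> B"
  shows "{w + (\<Sum>x\<in>insert b B. scale (c x) x) | w c. w \<in> W} = adjoin scale {w + (\<Sum>x\<in>B. scale (c x) x) | w c. w \<in> W} b"
    (is "?L = ?R")
proof
  show "?L \<subseteq> ?R"
  proof
    fix y assume "y \<in> ?L"
    then obtain w c where "y = w + (\<Sum>x\<in>insert b B. scale (c x) x)" "w \<in> W" by blast
    then have "y = (w + (\<Sum>x\<in>B. scale (c x) x)) + scale (c b) b" "w \<in> W"
      using assms by (simp_all add: ac_simps)
    then show "y \<in> ?R" unfolding adjoin_def by blast
  qed
  show "?R \<subseteq> ?L"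
  proof
    fix y assume "y \<in> ?R"
    then obtain w c d where y: "y = (w + (\<Sum>x\<in>B. scale (c x) x)) + scale d b" "w \<in> W"
      unfolding adjoin_def by blast
    have "(\<Sum>x\<in>B. scale ((c(b := d)) x) x) = (\<Sum>x\<in>B. scale (c x) x)"
      using assms by (intro sum.cong) auto
    then have "y = w + (\<Sum>x\<in>insert b B. scale ((c(b := d)) x) x)"
      using y assms by (simp add: ac_simps)
    then show "y \<in> ?L" using y(2) by blast
  qed
qed

lemma relative_basis_imp_finite_ext:
  assumes "finite B" "relative_basis scale W V B" "subspace W"
  shows "finite_ext scale W V (card B)"
  using assms(1,2)
proof (induction B arbitrary: V rule: finite_induct)
  case empty
  then show ?case by (simp add: relative_basis_def finite_ext_0)
next
  case (insert b B)
  let ?V = "{w + (\<Sum>x\<in>B. scale (c x) x) | w c. w \<in> W}"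
  have ind: "\<forall>x\<in>insert b B. c x = 0" if "(\<Sum>x\<in>insert b B. scale (c x) x) \<in> W" for c
    using insert(4) that unfolding relative_basis_def by blast
  have VB: "relative_basis scale W ?V B"
    unfolding relative_basis_def
  proof (intro conjI allI impI)
    show "finite B" "?V = ?V" by (rule insert(1), rule HOL.refl)
  next
    fix c assume "(\<Sum>x\<in>B. scale (c x) x) \<in> W"
    moreover have "(\<Sum>x\<in>insert b B. scale ((c(b := 0)) x) x) = (\<Sum>x\<in>B. scale (c x) x)"
      using insert(1,2) by (simp, intro sum.cong) auto
    ultimately have "\<forall>x\<in>insert b B. (c(b := 0)) x = 0" using ind by metis
    then show "\<forall>x\<in>B. c x = 0" using insert(2) by (metis fun_upd_other insertCI)
  qed
  have "b \<notin> ?V"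
  proof
    assume "b \<in> ?V"
    then obtain w c where b: "b = w + (\<Sum>x\<in>B. scale (c x) x)" "w \<in> W" by blast
    have s: "(\<Sum>x\<in>B. scale ((c(b := -1)) x) x) = (\<Sum>x\<in>B. scale (c x) x)"
      using insert(2) by (intro sum.cong) auto
    have "(\<Sum>x\<in>insert b B. scale ((c(b := -1)) x) x) = - b + (\<Sum>x\<in>B. scale (c x) x)"
      using insert(1,2) s by simp
    also have "\<dots> = - w"
      by (subst (1) b) simp
    finally have "(\<Sum>x\<in>insert b B. scale ((c(b := -1)) x) x) = - w" .
    then have "\<forall>x\<in>insert b B. (c(b := -1)) x = 0" using ind subspace_neg[OF assms(3) b(2)] by metis
    then show False by auto
  qed
  moreover have "V = adjoin scale ?V b"
    using insert(4) combination_insert[OF insert(1,2), of W] unfolding relative_basis_def by simp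
  ultimately show ?case using finite_ext.step[OF insert(3)[OF VB]] insert(1,2) by simp
qed

lemma finite_ext_imp_relative_basis:
  assumes "finite_ext scale W V n" "subspace W"
  shows "\<exists>B. relative_basis scale W V B \<and> card B = n"
  using assms(1)
proof (induction rule: finite_ext.induct)
  case refl
  show ?case by (rule exI[of _ "{}"]) (simp add: relative_basis_def)
next
  case (step V n b)
  then obtain B where B: "relative_basis scale W V B" "card B = n" by blast
  have fB: "finite B" and VB: "V = {w + (\<Sum>b\<in>B. scale (c b) b) | w c. w \<in> W}"
    and ind: "\<And>c. (\<Sum>b\<in>B. scale (c b) b) \<in> W \<Longrightarrow> \<forall>b\<in>B. c b = 0"
    using B(1) unfolding relative_basis_def by blast+
  have V: "subspace V" using finite_ext_subspace[OF step(1) assms(2)] .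
  have BV: "(\<Sum>b\<in>B. scale (c b) b) \<in> V" for c
  proof -
    have "(\<Sum>b\<in>B. scale (c b) b) = 0 + (\<Sum>b\<in>B. scale (c b) b) \<and> 0 \<in> W" using subspace_0[OF assms(2)] by simp
    then show ?thesis unfolding VB by blast
  qed
  have "B \<subseteq> V"
  proof
    fix x assume "x \<in> B"
    then have "(\<Sum>b\<in>B. scale (if b = x then 1 else 0) b) = x"
      using fB by (simp add: if_distrib[where f="\<lambda>c. scale c _"] sum.delta' cong: if_cong)
    then show "x \<in> V" using BV[of "\<lambda>b. if b = x then 1 else 0"] by simp
  qed
  then have bB: "b \<notin> B" using step(2) by blast
  have "relative_basis scale W (adjoin scale V b) (insert b B)"
    unfolding relative_basis_def
  proof (intro conjI allI impI)
    show "finite (insert b B)" using fB by simp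
    show "adjoin scale V b = {w + (\<Sum>x\<in>insert b B. scale (c x) x) | w c. w \<in> W}"
      using combination_insert[OF fB bB, of W] VB by simp
    fix c assume *: "(\<Sum>x\<in>insert b B. scale (c x) x) \<in> W"
    then have "scale (c b) b + (\<Sum>x\<in>B. scale (c x) x) \<in> V"
      using fB bB finite_ext_subset[OF step(1)] by auto
    then have "scale (c b) b \<in> V" using subspace_diff[OF V _ BV[of c]] by fastforce
    then have "scale (inverse (c b)) (scale (c b) b) \<in> V" using subspace_scale[OF V] by blast
    then have "c b = 0" using step(2) by (cases "c b = 0") auto
    then show "\<forall>x\<in>insert b B. c x = 0" using * fB bB ind[of c] by simp
  qed
  then show ?case using B(2) fB bB by (intro exI[of _ "insert b B"]) simp
qed

lemma coset_eq_iff: assumes "subspace W" shows "v +o W = u +o W \<longleftrightarrow> v - u \<in> W"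
proof
  assume "v +o W = u +o W"
  moreover have "v \<in> v +o W" using subspace_0[OF assms] by (force simp: elt_set_plus_def)
  ultimately obtain w where "v = u + w" "w \<in> W" by (auto simp: elt_set_plus_def)
  then show "v - u \<in> W" by simp
next
  assume *: "v - u \<in> W"
  have "v + w = u + ((v - u) + w)" "u + w = v + (w - (v - u))" for w by auto
  then show "v +o W = u +o W"
    using subspace_add[OF assms *] subspace_diff[OF assms _ *]
    unfolding elt_set_plus_def by blast
qed

lemma quotient_basis_iff_relative_basis:
  assumes W: "subspace W" and V: "subspace V" and WV: "W \<subseteq> V"
  shows "quotient_basis scale V W B \<longleftrightarrow> relative_basis scale W V B"
proof
  assume q: "quotient_basis scale V W B"
  then have fB: "finite B" and BV: "B \<subseteq> V" unfolding quotient_basis_def by auto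
  have ex: "\<exists>!c. c \<in> extensional B \<and> v - (\<Sum>b\<in>B. scale (c b) b) \<in> W" if "v \<in> V" for v
    using q that coset_eq_iff[OF W] unfolding quotient_basis_def by simp
  show "relative_basis scale W V B"
    unfolding relative_basis_def
  proof (intro conjI fB allI impI)
    show "V = {w + (\<Sum>b\<in>B. scale (c b) b) | w c. w \<in> W}"
    proof
      show "V \<subseteq> {w + (\<Sum>b\<in>B. scale (c b) b) | w c. w \<in> W}"
      proof
        fix v assume "v \<in> V"
        then obtain c where c: "v - (\<Sum>b\<in>B. scale (c b) b) \<in> W" using ex by blast
        then have "v = (v - (\<Sum>b\<in>B. scale (c b) b)) + (\<Sum>b\<in>B. scale (c b) b)" by simp
        with c show "v \<in> {w + (\<Sum>b\<in>B. scale (c b) b) | w c. w \<in> W}" by blast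
      qed
      show "{w + (\<Sum>b\<in>B. scale (c b) b) | w c. w \<in> W} \<subseteq> V"
        using WV BV V by (auto intro!: subspace_add subspace_sum subspace_scale)
    qed
    fix c assume c: "(\<Sum>b\<in>B. scale (c b) b) \<in> W"
    have "(\<Sum>b\<in>B. scale (restrict c B b) b) = (\<Sum>b\<in>B. scale (c b) b)" by (intro sum.cong) auto
    then have 1: "restrict c B \<in> extensional B \<and> 0 - (\<Sum>b\<in>B. scale (restrict c B b) b) \<in> W"
      using subspace_neg[OF W c] by auto
    have "(\<Sum>b\<in>B. scale (restrict (\<lambda>_. 0) B b) b) = 0" by (intro sum.neutral) auto
    then have 2: "restrict (\<lambda>_. 0) B \<in> extensional B \<and> 0 - (\<Sum>b\<in>B. scale (restrict (\<lambda>_. 0) B b) b) \<in> W"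
      using subspace_0[OF W] by auto
    have "restrict c B = restrict (\<lambda>_. 0) B" using ex[OF subspace_0[OF V]] 1 2 by blast
    then show "\<forall>b\<in>B. c b = 0" by (metis restrict_apply)
  qed
next
  assume r: "relative_basis scale W V B"
  then have fB: "finite B" and VB: "V = {w + (\<Sum>b\<in>B. scale (c b) b) | w c. w \<in> W}"
    and ind: "\<And>c. (\<Sum>b\<in>B. scale (c b) b) \<in> W \<Longrightarrow> \<forall>b\<in>B. c b = 0"
    unfolding relative_basis_def by blast+
  show "quotient_basis scale V W B"
    unfolding quotient_basis_def coset_eq_iff[OF W]
  proof (intro conjI fB ballI)
    show "B \<subseteq> V"
    proof
      fix x assume "x \<in> B"
      then have x: "0 + (\<Sum>b\<in>B. scale (if b = x then 1 else 0) b) = x"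
        using fB by (simp add: if_distrib[where f="\<lambda>c. scale c _"] sum.delta' cong: if_cong)
      have "0 + (\<Sum>b\<in>B. scale (c b) b) \<in> V" for c
        unfolding VB using subspace_0[OF W] by blast
      from this[of "\<lambda>b. if b = x then 1 else 0"] show "x \<in> V" unfolding x .
    qed
    fix v assume "v \<in> V"
    then obtain w c where v: "v = w + (\<Sum>b\<in>B. scale (c b) b)" "w \<in> W" unfolding VB by blast
    have "(\<Sum>b\<in>B. scale (restrict c B b) b) = (\<Sum>b\<in>B. scale (c b) b)" by (intro sum.cong) auto
    then have 1: "restrict c B \<in> extensional B \<and> v - (\<Sum>b\<in>B. scale (restrict c B b) b) \<in> W"
      using v by auto
    show "\<exists>!c. c \<in> extensional B \<and> v - (\<Sum>b\<in>B. scale (c b) b) \<in> W"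
    proof (rule ex1I, rule 1)
      fix d assume d: "d \<in> extensional B \<and> v - (\<Sum>b\<in>B. scale (d b) b) \<in> W"
      have "(\<Sum>b\<in>B. scale (d b - c b) b) = w - (v - (\<Sum>b\<in>B. scale (d b) b))"
        unfolding v by (simp add: scale_left_diff_distrib sum_subtractf)
      then have "\<forall>b\<in>B. d b - c b = 0" using ind[of "\<lambda>b. d b - c b"] subspace_diff[OF W v(2)] d by metis
      then show "d = restrict c B" using d by (intro extensionalityI[of _ B]) auto
    qed
  qed
qed

lemma quotient_finite_dim_iff:
  assumes "subspace W" "subspace V" "W \<subseteq> V"
  shows "quotient_finite_dim scale V W \<longleftrightarrow> (\<exists>n. finite_ext scale W V n)"
  unfolding quotient_finite_dim_def quotient_basis_iff_relative_basis[OF assms]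
  using relative_basis_imp_finite_ext finite_ext_imp_relative_basis assms(1)
  by (metis relative_basis_def)

lemma quotient_dim_eq:
  assumes "subspace W" "finite_ext scale W V n"
  shows "quotient_dim scale V W = n"
proof -
  have *: "subspace V" "W \<subseteq> V" using assms finite_ext_subspace finite_ext_subset by auto
  have "\<exists>B. quotient_basis scale V W B"
    using finite_ext_imp_relative_basis[OF assms(2,1)] quotient_basis_iff_relative_basis[OF assms(1) *] by blast
  then have "quotient_basis scale V W (SOME B. quotient_basis scale V W B)" by (rule someI_ex)
  then have "relative_basis scale W V (SOME B. quotient_basis scale V W B)"
    using quotient_basis_iff_relative_basis[OF assms(1) *] by blast
  then have "finite_ext scale W V (quotient_dim scale V W)"
    unfolding quotient_dim_def by (intro relative_basis_imp_finite_ext) (auto simp: relative_basis_def assms)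
  then show ?thesis using finite_ext_unique[OF assms(1) _ assms(2)] by blast
qed

lemma finite_ext_span: "finite B \<Longrightarrow> \<exists>n. finite_ext scale {0} (span B) n"
proof (induction B rule: finite_induct)
  case empty
  show ?case using finite_ext.refl[of scale "{0}"] by auto
next
  case (insert b B)
  then obtain n where n: "finite_ext scale {0} (span B) n" by blast
  have eq: "span (insert b B) = adjoin scale (span B) b"
  proof -
    have "x \<in> span (insert b B) \<longleftrightarrow> x \<in> adjoin scale (span B) b" for x
      unfolding span_breakdown_eq adjoin_def by (auto simp: algebra_simps) (metis add_diff_cancel_left' diff_add_cancel)+
    then show ?thesis by blast
  qed
  show ?case
  proof (cases "b \<in> span B")
    case True
    then show ?thesis using n eq adjoin_absorb[OF subspace_span True] by auto
  next
    case False
    then show ?thesis using finite_ext.step[OF n False] eq by auto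
  qed
qed

end

section \<open>Images and preimages of finite extensions\<close>

abbreviation real_ext :: "'a::real_vector set \<Rightarrow> 'a set \<Rightarrow> nat \<Rightarrow> bool" where
  "real_ext \<equiv> finite_ext scaleR"

lemma null_space_subspace: "linear f \<Longrightarrow> subspace (null_space f)"
  unfolding null_space_def by (rule linear_subspace_kernel)

lemma range_subspace: "linear f \<Longrightarrow> subspace (range f)"
  by (rule linear_subspace_image) auto

lemma linear_image_adjoin:
  assumes "linear f" shows "f ` adjoin scaleR V b = adjoin scaleR (f ` V) (f b)"
  unfolding adjoin_def using linear_add[OF assms] linear_scale[OF assms] by (auto simp: image_iff) metis+

text \<open>Rank-nullity for the restriction of \<open>f\<close> to a finite extension. A new vector \<open>b\<close> either has \<open>f b\<close> outside of the
old image, or can be corrected by an old vector to lie in the kernel of \<open>f\<close>.\<close>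

lemma finite_ext_image:
  fixes f :: "'a::real_vector \<Rightarrow> 'b::real_vector"
  assumes f: "linear f" and "real_ext W V n" and W: "subspace W"
  shows "\<exists>k l. real_ext (f ` W) (f ` V) k \<and> real_ext (W \<inter> null_space f) (V \<inter> null_space f) l \<and> k + l = n"
  using assms(2)
proof (induction rule: finite_ext.induct)
  case refl
  show ?case using finite_ext.refl[of scaleR "f ` W"] finite_ext.refl[of scaleR "W \<inter> null_space f"] add_0 by blast
next
  case (step V n b)
  then obtain k l where kl: "real_ext (f ` W) (f ` V) k"
    "real_ext (W \<inter> null_space f) (V \<inter> null_space f) l" "k + l = n" by blast
  have V: "subspace V" using real_vector.finite_ext_subspace[OF step(1) W] .
  have fV: "subspace (f ` V)" using linear_subspace_image[OF f V] .
  note img = linear_image_adjoin[OF f, of V b]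
  show ?case
  proof (cases "f b \<in> f ` V")
    case True
    then obtain v where v: "f b = f v" "v \<in> V" by blast
    let ?u = "b - v"
    have u: "?u \<in> null_space f" using v by (simp add: null_space_def linear_diff[OF f])
    have unV: "?u \<notin> V" using step(2) v(2) subspace_add[OF V, of "b - v" v] by auto
    have "?u \<in> adjoin scaleR V b"
      using real_vector.adjoin_mem[OF V, of b] real_vector.adjoin_superset[of V b] v(2)
        real_vector.subspace_adjoin[OF V, of b] by (intro subspace_diff) auto
    then have eq: "adjoin scaleR V b = adjoin scaleR V ?u"
      using real_vector.adjoin_exchange[OF V _ unV] by simp
    have "real_ext (W \<inter> null_space f) (adjoin scaleR V b \<inter> null_space f) (Suc l)"
      using finite_ext.step[OF kl(2), of ?u] unV 
        real_vector.adjoin_Int[OF null_space_subspace[OF f] u, of V] eq by auto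
    moreover have "f ` adjoin scaleR V b = f ` V"
      using img real_vector.adjoin_absorb[OF fV True] by simp
    ultimately show ?thesis using kl by (metis add_Suc_right)
  next
    case False
    have "adjoin scaleR V b \<inter> null_space f = V \<inter> null_space f"
    proof
      show "V \<inter> null_space f \<subseteq> adjoin scaleR V b \<inter> null_space f" using real_vector.adjoin_superset by blast
      show "adjoin scaleR V b \<inter> null_space f \<subseteq> V \<inter> null_space f"
      proof
        fix x assume x: "x \<in> adjoin scaleR V b \<inter> null_space f"
        then obtain v c where vc: "x = v + c *\<^sub>R b" "v \<in> V" unfolding adjoin_def by blast
        have "c = 0"
        proof (rule ccontr)
          assume c: "c \<noteq> 0"
          have "f v + c *\<^sub>R f b = 0" using x vc by (simp add: null_space_def linear_add[OF f] linear_scale[OF f])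
          then have "c *\<^sub>R f b = - f v" by (simp add: eq_neg_iff_add_eq_0 add.commute)
          then have "f b = inverse c *\<^sub>R - f v" using c by (metis scaleR_one scaleR_scaleR left_inverse)
          then show False using False vc(2) fV by (metis imageI subspace_neg subspace_scale)
        qed
        then show "x \<in> V \<inter> null_space f" using x vc by auto
      qed
    qed
    moreover have "real_ext (f ` W) (f ` adjoin scaleR V b) (Suc k)"
      using finite_ext.step[OF kl(1) False] img by simp
    ultimately show ?thesis using kl by (metis add_Suc)
  qed
qed

lemma finite_ext_vimage_range:
  fixes f :: "'a::real_vector \<Rightarrow> 'b::real_vector"
  assumes f: "linear f" and "real_ext W V n" and W: "subspace W" and "V \<subseteq> range f"
  shows "real_ext (f -` W) (f -` V) n"
  using assms(2,4)
proof (induction rule: finite_ext.induct)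
  case refl
  show ?case by (rule finite_ext.refl)
next
  case (step V n b)
  have V: "subspace V" using real_vector.finite_ext_subspace[OF step(1) W] .
  from step(4) have "V \<subseteq> range f" "b \<in> range f"
    using real_vector.adjoin_superset[of V b] real_vector.adjoin_mem[OF V, of b] by auto
  then obtain x where x: "b = f x" and IH: "real_ext (f -` W) (f -` V) n" using step(3) by blast
  have "f -` adjoin scaleR V (f x) = adjoin scaleR (f -` V) x"
  proof
    show "f -` adjoin scaleR V (f x) \<subseteq> adjoin scaleR (f -` V) x"
    proof
      fix y assume "y \<in> f -` adjoin scaleR V (f x)"
      then obtain v c where vc: "f y = v + c *\<^sub>R f x" "v \<in> V" unfolding adjoin_def by auto
      then have "f (y - c *\<^sub>R x) = v" by (simp add: linear_diff[OF f] linear_scale[OF f])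
      moreover have "y = (y - c *\<^sub>R x) + c *\<^sub>R x" by simp
      ultimately show "y \<in> adjoin scaleR (f -` V) x" unfolding adjoin_def using vc(2) by blast
    qed
    show "adjoin scaleR (f -` V) x \<subseteq> f -` adjoin scaleR V (f x)"
      unfolding adjoin_def by (auto simp: linear_add[OF f] linear_scale[OF f]) blast
  qed
  moreover have "x \<notin> f -` V" using step(2) x by auto
  ultimately show ?case using finite_ext.step[OF IH, of x] x by simp
qed

lemma finite_ext_vimage:
  fixes f :: "'a::real_vector \<Rightarrow> 'b::real_vector"
  assumes f: "linear f" and VW: "real_ext W V n" and W: "subspace W"
  shows "\<exists>k. real_ext (f -` W) (f -` V) k"
proof -
  obtain k where "real_ext (W \<inter> range f) (V \<inter> range f) k"
    using real_vector.finite_ext_Int[OF VW W range_subspace[OF f]] by blast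
  then have "real_ext (f -` (W \<inter> range f)) (f -` (V \<inter> range f)) k"
    using finite_ext_vimage_range[OF f] subspace_inter[OF W range_subspace[OF f]] by blast
  moreover have "f -` (X \<inter> range f) = f -` X" for X by auto
  ultimately show ?thesis by auto
qed

section \<open>Relative dimension of commensurable subspaces\<close>

definition commensurable :: "'a::real_vector set \<Rightarrow> 'a set \<Rightarrow> bool" where
  "commensurable V W \<longleftrightarrow> subspace V \<and> subspace W \<and>
     quotient_finite_dim scaleR V (V \<inter> W) \<and> quotient_finite_dim scaleR W (V \<inter> W)"

text \<open>The dimension of \<open>V\<close> minus that of \<open>W\<close>, with a meaning also when both are infinite.\<close>

definition relative_dim :: "'a::real_vector set \<Rightarrow> 'a set \<Rightarrow> int" where
  "relative_dim V W = int (quotient_dim scaleR V (V \<inter> W)) - int (quotient_dim scaleR W (V \<inter> W))"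

text \<open>Any common subspace of finite codimension may serve in place of \<open>V \<inter> W\<close>.\<close>

lemma commensurableI:
  assumes U: "subspace U" and V: "real_ext U V m" and W: "real_ext U W n"
  shows "commensurable V W" "relative_dim V W = int m - int n"
proof -
  have sV: "subspace V" and sW: "subspace W" and sub: "U \<subseteq> V" "U \<subseteq> W"
    using assms real_vector.finite_ext_subspace real_vector.finite_ext_subset by blast+
  have sI: "subspace (V \<inter> W)" using subspace_inter[OF sV sW] .
  obtain k l where kl: "real_ext U (V \<inter> W) k" "real_ext (V \<inter> W) V l" "k + l = m"
    using real_vector.finite_ext_between[OF V U sI] sub by blast
  obtain k' l' where kl': "real_ext U (V \<inter> W) k'" "real_ext (V \<inter> W) W l'" "k' + l' = n"
    using real_vector.finite_ext_between[OF W U sI] sub by blast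
  have "k = k'" using real_vector.finite_ext_unique[OF U] kl kl' by blast
  then show "relative_dim V W = int m - int n"
    unfolding relative_dim_def real_vector.quotient_dim_eq[OF sI kl(2)] real_vector.quotient_dim_eq[OF sI kl'(2)]
    using kl kl' by simp
  show "commensurable V W"
    unfolding commensurable_def using real_vector.quotient_finite_dim_iff[OF sI] sV sW kl kl' by blast
qed

lemma commensurableE:
  assumes "commensurable V W"
  obtains m n where "subspace V" "subspace W" "real_ext (V \<inter> W) V m" "real_ext (V \<inter> W) W n"
    "relative_dim V W = int m - int n"
proof -
  have s: "subspace V" "subspace W" using assms unfolding commensurable_def by auto
  note sI = subspace_inter[OF s]
  obtain m n where "real_ext (V \<inter> W) V m" "real_ext (V \<inter> W) W n"
    using assms real_vector.quotient_finite_dim_iff[OF sI] s unfolding commensurable_def by blast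
  then show ?thesis using that s commensurableI[OF sI] by blast
qed

lemma commensurable_sym:
  assumes "commensurable V W"
  shows "commensurable W V" "relative_dim W V = - relative_dim V W"
  using assms unfolding commensurable_def relative_dim_def by (auto simp: Int_commute)

text \<open>All three relative dimensions can be computed from the triple intersection.\<close>

lemma commensurable_trans:
  assumes "commensurable V W" "commensurable W X"
  shows "commensurable V X" "relative_dim V X = relative_dim V W + relative_dim W X"
proof -
  obtain m n where VW: "subspace V" "subspace W" "real_ext (V \<inter> W) V m" "real_ext (V \<inter> W) W n"
    "relative_dim V W = int m - int n" using commensurableE[OF assms(1)] by blast
  obtain p q where WX: "subspace X" "real_ext (W \<inter> X) W p" "real_ext (W \<inter> X) X q"
    "relative_dim W X = int p - int q" using commensurableE[OF assms(2)] by blast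
  let ?U = "V \<inter> W \<inter> X"
  have sVW: "subspace (V \<inter> W)" and sWX: "subspace (W \<inter> X)" using VW WX subspace_inter by blast+
  have sU: "subspace ?U" using subspace_inter[OF sVW WX(1)] .
  have eqs: "V \<inter> W \<inter> (W \<inter> X) = ?U" "W \<inter> X \<inter> (V \<inter> W) = ?U" "W \<inter> (W \<inter> X) = W \<inter> X" "W \<inter> (V \<inter> W) = V \<inter> W"
    by auto
  obtain k where k: "real_ext ?U (W \<inter> X) k"
    using real_vector.finite_ext_Int[OF VW(4) sVW sWX] eqs by auto
  obtain l where l: "real_ext ?U (V \<inter> W) l"
    using real_vector.finite_ext_Int[OF WX(2) sWX sVW] eqs by auto
  have UV: "real_ext ?U V (l + m)" and UX: "real_ext ?U X (k + q)"
    and UW: "real_ext ?U W (l + n)" "real_ext ?U W (k + p)"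
    using finite_ext_trans k l VW WX by blast+
  have "l + n = k + p" using real_vector.finite_ext_unique[OF sU UW] .
  then show "relative_dim V X = relative_dim V W + relative_dim W X"
    using commensurableI(2)[OF sU UV UX] VW(5) WX(4) by simp
  show "commensurable V X" using commensurableI(1)[OF sU UV UX] .
qed

section \<open>Pairs of operators modulo finite rank\<close>

text \<open>For linear maps, to agree on a subspace of finite codimension is the same as to differ by a map of finite rank.
Agreement on such a subspace is the form in which kernels and ranges of the two maps can be compared.\<close>

definition eq_upto_finite_rank :: "('a::real_vector \<Rightarrow> 'b::real_vector) \<Rightarrow> ('a \<Rightarrow> 'b) \<Rightarrow> bool"  (infix "\<simeq>" 50) where
  "f \<simeq> g \<longleftrightarrow> (\<exists>M n. subspace M \<and> real_ext M UNIV n \<and> (\<forall>x\<in>M. f x = g x))"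

lemma finite_codim_Int:
  assumes "subspace M" "real_ext M UNIV m" "subspace M'" "real_ext M' UNIV m'"
  shows "\<exists>k. real_ext (M \<inter> M') UNIV k"
proof -
  obtain k where "real_ext (M \<inter> M') (UNIV \<inter> M') k" using real_vector.finite_ext_Int[OF assms(2,1,3)] by blast
  then show ?thesis using finite_ext_trans[OF assms(4)] by auto
qed



lemma eq_upto_finite_rank_sym: "f \<simeq> g \<Longrightarrow> g \<simeq> f"
  unfolding eq_upto_finite_rank_def by metis

lemma eq_upto_finite_rank_trans:
  assumes "f \<simeq> g" "g \<simeq> h" shows "f \<simeq> h"
proof -
  obtain M m where M: "subspace M" "real_ext M UNIV m" "\<forall>x\<in>M. f x = g x"
    using assms(1) unfolding eq_upto_finite_rank_def by blast
  obtain N n where N: "subspace N" "real_ext N UNIV n" "\<forall>x\<in>N. g x = h x"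
    using assms(2) unfolding eq_upto_finite_rank_def by blast
  have "subspace (M \<inter> N)" "\<exists>k. real_ext (M \<inter> N) UNIV k" "\<forall>x\<in>M \<inter> N. f x = h x"
    using finite_codim_Int[OF M(1,2) N(1,2)] M N subspace_inter by auto
  then show ?thesis unfolding eq_upto_finite_rank_def by blast
qed

lemma eq_upto_finite_rank_add:
  assumes "f \<simeq> g" "f' \<simeq> g'" shows "(\<lambda>x. f x + f' x) \<simeq> (\<lambda>x. g x + g' x)"
proof -
  obtain M m where M: "subspace M" "real_ext M UNIV m" "\<forall>x\<in>M. f x = g x"
    using assms(1) unfolding eq_upto_finite_rank_def by blast
  obtain N n where N: "subspace N" "real_ext N UNIV n" "\<forall>x\<in>N. f' x = g' x"
    using assms(2) unfolding eq_upto_finite_rank_def by blast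
  have "subspace (M \<inter> N)" "\<exists>k. real_ext (M \<inter> N) UNIV k" "\<forall>x\<in>M \<inter> N. f x + f' x = g x + g' x"
    using finite_codim_Int[OF M(1,2) N(1,2)] M N subspace_inter by auto
  then show ?thesis unfolding eq_upto_finite_rank_def by blast
qed

text \<open>On a common domain \<open>M\<close> of codimension \<open>n\<close> the two maps have the same kernel and image. By rank-nullity the passage
from \<open>M\<close> to the whole space adds, for each of the maps, \<open>n\<close> dimensions in total to kernel and range.\<close>

lemma relative_dim_kernel_plus_range:
  fixes f g :: "'a::real_vector \<Rightarrow> 'b::real_vector"
  assumes f: "linear f" and g: "linear g" and "f \<simeq> g"
  shows "commensurable (null_space f) (null_space g)" "commensurable (range f) (range g)"
    "relative_dim (null_space f) (null_space g) + relative_dim (range f) (range g) = 0"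
proof -
  obtain M n where M: "subspace M" "real_ext M UNIV n" "\<forall>x\<in>M. f x = g x"
    using assms(3) unfolding eq_upto_finite_rank_def by blast
  obtain k l where kl: "real_ext (f ` M) (range f) k" "real_ext (M \<inter> null_space f) (null_space f) l" "k + l = n"
    using finite_ext_image[OF f M(2,1)] by auto
  obtain k' l' where kl': "real_ext (g ` M) (range g) k'" "real_ext (M \<inter> null_space g) (null_space g) l'" "k' + l' = n"
    using finite_ext_image[OF g M(2,1)] by auto
  have eq: "g ` M = f ` M" "M \<inter> null_space g = M \<inter> null_space f"
    using M(3) by (auto simp: null_space_def image_iff)
  have s: "subspace (f ` M)" "subspace (M \<inter> null_space f)"
    using linear_subspace_image[OF f M(1)] subspace_inter[OF M(1) null_space_subspace[OF f]] by auto
  note a = commensurableI[OF s(1) kl(1) kl'(1)[unfolded eq]]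
  note b = commensurableI[OF s(2) kl(2) kl'(2)[unfolded eq]]
  show "commensurable (null_space f) (null_space g)" "commensurable (range f) (range g)"
    "relative_dim (null_space f) (null_space g) + relative_dim (range f) (range g) = 0"
    using a b kl kl' by auto
qed

text \<open>The purely algebraic part of the notion of a Fredholm pair over the reals.\<close>

definition commensurable_pair :: "('a::real_vector \<Rightarrow> 'b::real_vector) \<Rightarrow> ('b \<Rightarrow> 'a) \<Rightarrow> bool" where
  "commensurable_pair S T \<longleftrightarrow> commensurable (null_space S) (range T) \<and> commensurable (null_space T) (range S)"

abbreviation pair_index :: "('a::real_normed_vector \<Rightarrow> 'b::real_normed_vector) \<Rightarrow> ('b \<Rightarrow> 'a) \<Rightarrow> int" where
  "pair_index \<equiv> fredholm_index scaleR scaleR"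

lemma pair_index_eq_relative_dim:
  "pair_index S T = relative_dim (null_space S) (range T) - relative_dim (null_space T) (range S)"
  unfolding fredholm_index_def relative_dim_def by simp

lemma commensurable_pair_swap: "commensurable_pair S T \<longleftrightarrow> commensurable_pair T S" "pair_index T S = - pair_index S T"
  unfolding commensurable_pair_def pair_index_eq_relative_dim by auto

lemma commensurable_pair_cong_left:
  fixes S S' :: "'a::real_normed_vector \<Rightarrow> 'b::real_normed_vector"
  assumes "linear S" "linear S'" "S \<simeq> S'" "commensurable_pair S T"
  shows "commensurable_pair S' T" "pair_index S' T = pair_index S T"
proof -
  note kr = relative_dim_kernel_plus_range[OF assms(2,1) eq_upto_finite_rank_sym[OF assms(3)]]
  have st: "commensurable (null_space S) (range T)" "commensurable (null_space T) (range S)"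
    using assms(4) unfolding commensurable_pair_def by auto
  note a = commensurable_trans[OF kr(1) st(1)]
  note b = commensurable_trans[OF st(2) commensurable_sym(1)[OF kr(2)]]
  show "commensurable_pair S' T" unfolding commensurable_pair_def using a b by blast
  show "pair_index S' T = pair_index S T"
    unfolding pair_index_eq_relative_dim using a(2) b(2) kr(3) commensurable_sym(2)[OF kr(2)] by simp
qed

lemma commensurable_pair_cong:
  fixes S S' :: "'a::real_normed_vector \<Rightarrow> 'b::real_normed_vector"
  assumes "linear S" "linear S'" "linear T" "linear T'" "S \<simeq> S'" "T \<simeq> T'" "commensurable_pair S T"
  shows "commensurable_pair S' T'" "pair_index S' T' = pair_index S T"
proof -
  note a = commensurable_pair_cong_left[OF assms(1,2,5,7)]
  have b: "commensurable_pair T S'" using a(1) commensurable_pair_swap by blast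
  note c = commensurable_pair_cong_left[OF assms(3,4,6) b]
  show "commensurable_pair S' T'" using c(1) commensurable_pair_swap by blast
  show "pair_index S' T' = pair_index S T" using c(2) a(2) commensurable_pair_swap(2)[of S'] by simp
qed

section \<open>Orthogonal projections and adjoints\<close>

text \<open>A minimizing sequence for the distance from \<open>x\<close> to \<open>M\<close> is Cauchy by the parallelogram law, and the error at a
minimizer is orthogonal to \<open>M\<close> because moving the minimizer along \<open>m \<in> M\<close> cannot decrease the distance.\<close>

lemma orthogonal_projection_exists:
  fixes x :: "'a::{real_inner, complete_space}"
  assumes "closed M" and M: "subspace M"
  shows "\<exists>p\<in>M. \<forall>m\<in>M. (x - p) \<bullet> m = 0"
proof -
  define D where "D = (INF m\<in>M. (norm (x - m))\<^sup>2)"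
  have M0: "0 \<in> M" using subspace_0[OF M] .
  have bdd: "bdd_below ((\<lambda>m. (norm (x - m))\<^sup>2) ` M)" by (rule bdd_belowI[of _ 0]) auto
  have D: "D \<le> (norm (x - m))\<^sup>2" if "m \<in> M" for m
    unfolding D_def by (rule cINF_lower[OF bdd that])
  have "\<exists>m\<in>M. (norm (x - m))\<^sup>2 < D + 1 / real (Suc n)" for n
  proof (rule ccontr)
    assume "\<not> ?thesis"
    then have "D + 1 / real (Suc n) \<le> D"
      unfolding D_def[symmetric] by (subst (2) D_def, intro cINF_greatest) (use M0 in auto)
    then show False by simp
  qed
  then obtain p where p: "\<And>n. p n \<in> M" "\<And>n. (norm (x - p n))\<^sup>2 < D + 1 / real (Suc n)" by metis
  have par: "(norm (p n - p m))\<^sup>2 \<le> 2 / real (Suc n) + 2 / real (Suc m)" for n m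
  proof -
    \<comment> \<open>the midpoint lies in \<open>M\<close>, so its squared distance to \<open>x\<close> is at least \<open>D\<close>\<close>
    have "(1/2) *\<^sub>R (p n + p m) \<in> M" using p(1) by (intro subspace_scale[OF M] subspace_add[OF M])
    then have "D \<le> (norm (x - (1/2) *\<^sub>R (p n + p m)))\<^sup>2" by (rule D)
    moreover have "(norm (p n - p m))\<^sup>2 = 2 * (norm (x - p n))\<^sup>2 + 2 * (norm (x - p m))\<^sup>2
        - 4 * (norm (x - (1/2) *\<^sub>R (p n + p m)))\<^sup>2"
      unfolding power2_norm_eq_inner by (simp add: algebra_simps inner_commute)
    ultimately show ?thesis using p(2)[of n] p(2)[of m] by simp
  qed
  have "Cauchy p"
  proof (rule metric_CauchyI)
    fix e :: real assume e: "0 < e"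
    obtain N where N: "4 / real (Suc N) < e\<^sup>2"
    proof -
      obtain N where "inverse (real (Suc N)) < e\<^sup>2 / 4" using reals_Archimedean[of "e\<^sup>2 / 4"] e by auto
      then show ?thesis using that[of N] by (simp add: field_simps)
    qed
    have "dist (p m) (p n) < e" if "m \<ge> N" "n \<ge> N" for m n
    proof -
      have "2 / real (Suc m) \<le> 2 / real (Suc N)" "2 / real (Suc n) \<le> 2 / real (Suc N)"
        using that by (auto intro!: divide_left_mono)
      then have "(norm (p m - p n))\<^sup>2 < e\<^sup>2" using par[of m n] N by simp
      then show ?thesis using e by (simp add: dist_norm power2_less_imp_less)
    qed
    then show "\<exists>N. \<forall>m\<ge>N. \<forall>n\<ge>N. dist (p m) (p n) < e" by blast
  qed
  then obtain q where q: "p \<longlonglongrightarrow> q" using Cauchy_convergent convergent_def by blast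
  have qM: "q \<in> M" using closed_sequentially[OF assms(1)] p(1) q by blast
  have "(\<lambda>n. (norm (x - p n))\<^sup>2) \<longlonglongrightarrow> (norm (x - q))\<^sup>2" by (intro tendsto_intros q)
  moreover have "(\<lambda>n. D + 1 / real (Suc n)) \<longlonglongrightarrow> D + 0"
    using LIMSEQ_inverse_real_of_nat by (intro tendsto_intros) (simp add: inverse_eq_divide)
  ultimately have qD: "(norm (x - q))\<^sup>2 \<le> D"
    using p(2) by (intro LIMSEQ_le[of _ "(norm (x - q))\<^sup>2" _ D]) (auto intro: less_imp_le)
  have "(x - q) \<bullet> m = 0" if m: "m \<in> M" for m
  proof (cases "m = 0")
    case False
    \<comment> \<open>this \<open>t\<close> minimizes the distance from \<open>x\<close> to the line \<open>q + t m\<close>\<close>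
    define t where "t = ((x - q) \<bullet> m) / (m \<bullet> m)"
    have mm: "m \<bullet> m > 0" using False by simp
    have "q + t *\<^sub>R m \<in> M" using qM m by (intro subspace_add[OF M] subspace_scale[OF M])
    then have "(norm (x - q))\<^sup>2 \<le> (norm (x - (q + t *\<^sub>R m)))\<^sup>2" using order_trans[OF qD D] by blast
    also have "\<dots> = (norm (x - q))\<^sup>2 - 2 * t * ((x - q) \<bullet> m) + t\<^sup>2 * (m \<bullet> m)"
      unfolding power2_norm_eq_inner by (simp add: algebra_simps inner_commute power2_eq_square)
    also have "\<dots> = (norm (x - q))\<^sup>2 - ((x - q) \<bullet> m)\<^sup>2 / (m \<bullet> m)"
      unfolding t_def using mm by (simp add: power2_eq_square field_simps)
    finally have "((x - q) \<bullet> m)\<^sup>2 / (m \<bullet> m) \<le> 0" by simp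
    then show ?thesis using mm by (simp add: divide_le_0_iff)
  qed simp
  then show ?thesis using qM by blast
qed

definition orth_proj :: "'a::{real_inner, complete_space} set \<Rightarrow> 'a \<Rightarrow> 'a" where
  "orth_proj M x = (SOME p. p \<in> M \<and> (\<forall>m\<in>M. (x - p) \<bullet> m = 0))"

context
  fixes M :: "'a::{real_inner, complete_space} set"
  assumes closed_M: "closed M" and M: "subspace M"
begin

lemma orth_proj_mem: "orth_proj M x \<in> M" and orth_proj_orth: "m \<in> M \<Longrightarrow> (x - orth_proj M x) \<bullet> m = 0"
proof -
  have "\<exists>p. p \<in> M \<and> (\<forall>m\<in>M. (x - p) \<bullet> m = 0)" using orthogonal_projection_exists[OF closed_M M] by blast
  from someI_ex[OF this] show "orth_proj M x \<in> M" "m \<in> M \<Longrightarrow> (x - orth_proj M x) \<bullet> m = 0"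
    unfolding orth_proj_def by auto
qed

lemma orth_proj_unique:
  assumes "p \<in> M" "\<And>m. m \<in> M \<Longrightarrow> (x - p) \<bullet> m = 0" shows "orth_proj M x = p"
proof -
  have d: "orth_proj M x - p \<in> M" using orth_proj_mem assms(1) by (intro subspace_diff[OF M])
  have "(orth_proj M x - p) \<bullet> (orth_proj M x - p) = (x - p) \<bullet> (orth_proj M x - p) - (x - orth_proj M x) \<bullet> (orth_proj M x - p)"
    by (simp add: inner_diff_left)
  also have "\<dots> = 0" using assms(2)[OF d] orth_proj_orth[OF d] by simp
  finally show ?thesis by simp
qed

lemma orth_proj_id: "x \<in> M \<Longrightarrow> orth_proj M x = x"
  by (rule orth_proj_unique) auto

lemma orth_proj_eq_0_iff: "orth_proj M x = 0 \<longleftrightarrow> (\<forall>m\<in>M. x \<bullet> m = 0)"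
  using orth_proj_unique[of 0 x] subspace_0[OF M] orth_proj_orth[of _ x] by (metis diff_zero)

lemma orth_proj_linear: "linear (orth_proj M)"
proof (rule linearI)
  show "orth_proj M (x + y) = orth_proj M x + orth_proj M y" for x y
  proof (rule orth_proj_unique)
    fix m assume m: "m \<in> M"
    have "(x + y - (orth_proj M x + orth_proj M y)) \<bullet> m = (x - orth_proj M x) \<bullet> m + (y - orth_proj M y) \<bullet> m"
      by (simp add: algebra_simps)
    then show "(x + y - (orth_proj M x + orth_proj M y)) \<bullet> m = 0" using orth_proj_orth[OF m] by simp
  qed (intro subspace_add[OF M] orth_proj_mem)
  show "orth_proj M (c *\<^sub>R x) = c *\<^sub>R orth_proj M x" for c x
  proof (rule orth_proj_unique)
    fix m assume m: "m \<in> M"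
    have "(c *\<^sub>R x - c *\<^sub>R orth_proj M x) \<bullet> m = c * ((x - orth_proj M x) \<bullet> m)"
      by (simp add: algebra_simps)
    then show "(c *\<^sub>R x - c *\<^sub>R orth_proj M x) \<bullet> m = 0" using orth_proj_orth[OF m] by simp
  qed (intro subspace_scale[OF M] orth_proj_mem)
qed

lemma orth_proj_selfadjoint: "orth_proj M x \<bullet> y = x \<bullet> orth_proj M y"
proof -
  have "orth_proj M x \<bullet> y = orth_proj M x \<bullet> orth_proj M y + (y - orth_proj M y) \<bullet> orth_proj M x"
    by (simp add: algebra_simps inner_commute)
  moreover have "x \<bullet> orth_proj M y = orth_proj M x \<bullet> orth_proj M y + (x - orth_proj M x) \<bullet> orth_proj M y"
    by (simp add: algebra_simps inner_commute)
  ultimately show ?thesis using orth_proj_orth[OF orth_proj_mem] by simp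
qed

lemma orth_proj_pythagoras: "(norm x)\<^sup>2 = (norm (orth_proj M x))\<^sup>2 + (norm (x - orth_proj M x))\<^sup>2"
  using orth_proj_orth[OF orth_proj_mem, of x x] unfolding power2_norm_eq_inner
  by (simp add: algebra_simps inner_commute)

lemma norm_orth_proj_le: "norm (orth_proj M x) \<le> norm x" and norm_diff_orth_proj_le: "norm (x - orth_proj M x) \<le> norm x"
proof -
  have "0 \<le> (norm (orth_proj M x))\<^sup>2" "0 \<le> (norm (x - orth_proj M x))\<^sup>2" by simp_all
  with orth_proj_pythagoras[of x]
  have "(norm (orth_proj M x))\<^sup>2 \<le> (norm x)\<^sup>2" "(norm (x - orth_proj M x))\<^sup>2 \<le> (norm x)\<^sup>2" by linarith+
  then show "norm (orth_proj M x) \<le> norm x" "norm (x - orth_proj M x) \<le> norm x"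
    by (auto dest: power2_le_imp_le)
qed

lemma orth_proj_bounded_linear: "bounded_linear (orth_proj M)"
  using norm_orth_proj_le by (intro bounded_linear_intro[of _ 1] linear_add[OF orth_proj_linear] linear_scale[OF orth_proj_linear]) auto

lemma norm_diff_orth_proj_le_dist: assumes "m \<in> M" shows "norm (x - orth_proj M x) \<le> norm (x - m)"
proof -
  have "(x - m) - orth_proj M (x - m) = x - orth_proj M x"
    using orth_proj_id[OF assms] by (simp add: linear_diff[OF orth_proj_linear])
  from norm_diff_orth_proj_le[of "x - m", unfolded this] show ?thesis .
qed

end

lemma closed_null_space: "bounded_linear f \<Longrightarrow> closed (null_space f)"
  unfolding null_space_def
  by (intro closed_Collect_eq continuous_intros linear_continuous_on)

text \<open>The representing vector is a multiple of a vector \<open>u\<close> orthogonal to the kernel, which is a hyperplane.\<close>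

lemma riesz_representation:
  fixes f :: "'a::{real_inner, complete_space} \<Rightarrow> real"
  assumes "bounded_linear f" shows "\<exists>z. \<forall>x. f x = x \<bullet> z"
proof (cases "\<forall>x. f x = 0")
  case True
  then show ?thesis by (intro exI[of _ 0]) simp
next
  case False
  then obtain x0 where x0: "f x0 \<noteq> 0" by blast
  interpret bounded_linear f by fact
  let ?N = "null_space f"
  have N: "closed ?N" "subspace ?N"
    using closed_null_space[OF assms] null_space_subspace[of f] linear_axioms by auto
  define u where "u = x0 - orth_proj ?N x0"
  have fu: "f u \<noteq> 0" using orth_proj_mem[OF N, of x0] x0 unfolding u_def by (simp add: null_space_def diff)
  have uu: "u \<bullet> u \<noteq> 0" using fu by auto
  have "f x = x \<bullet> ((f u / (u \<bullet> u)) *\<^sub>R u)" for x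
  proof -
    have "x - (f x / f u) *\<^sub>R u \<in> ?N" using fu by (simp add: null_space_def diff scaleR)
    then have "u \<bullet> (x - (f x / f u) *\<^sub>R u) = 0" unfolding u_def by (rule orth_proj_orth[OF N])
    then have "x \<bullet> u = (f x / f u) * (u \<bullet> u)" by (simp add: inner_diff_right inner_commute)
    then show ?thesis using fu uu by simp
  qed
  then show ?thesis by blast
qed

lemma inner_adjoint:
  fixes f :: "'a::{real_inner, complete_space} \<Rightarrow> 'b::real_inner"
  assumes "bounded_linear f" shows "f x \<bullet> y = x \<bullet> adjoint f y"
proof -
  have "\<exists>z. \<forall>x. f x \<bullet> y = x \<bullet> z" for y
    by (rule riesz_representation) (intro bounded_linear_inner_left_comp assms)
  then have "\<exists>f'. \<forall>x y. f x \<bullet> y = x \<bullet> f' y" by metis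
  from someI_ex[OF this] show ?thesis unfolding adjoint_def by blast
qed

lemma adjoint_norm_le:
  fixes f :: "'a::{real_inner, complete_space} \<Rightarrow> 'b::real_inner"
  assumes f: "bounded_linear f" and B: "\<And>x. norm (f x) \<le> B * norm x" "0 \<le> B"
  shows "norm (adjoint f y) \<le> B * norm y"
proof (cases "adjoint f y = 0")
  case True
  then show ?thesis using B(2) by simp
next
  case False
  have "norm (adjoint f y) * norm (adjoint f y) = adjoint f y \<bullet> adjoint f y"
    by (simp add: norm_eq_sqrt_inner)
  also have "\<dots> = f (adjoint f y) \<bullet> y" using inner_adjoint[OF f] by simp
  also have "\<dots> \<le> norm (f (adjoint f y)) * norm y" by (rule norm_cauchy_schwarz)
  also have "\<dots> \<le> (B * norm (adjoint f y)) * norm y" by (intro mult_right_mono B) auto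
  finally show ?thesis using False by (simp add: mult.commute mult.left_commute)
qed

lemma adjoint_bounded_linear:
  fixes f :: "'a::{real_inner, complete_space} \<Rightarrow> 'b::real_inner"
  assumes f: "bounded_linear f" shows "bounded_linear (adjoint f)"
proof -
  obtain B where "0 \<le> B" and B: "\<And>x. norm (f x) \<le> B * norm x" 
    using bounded_linear.nonneg_bounded[OF f] by (auto simp: mult.commute)
  show ?thesis
  proof (rule bounded_linear_intro[of _ B])
    show "adjoint f (x + y) = adjoint f x + adjoint f y" for x y
      by (subst vector_eq_ldot[symmetric]) (simp add: inner_adjoint[OF f, symmetric] inner_add_right)
    show "adjoint f (c *\<^sub>R x) = c *\<^sub>R adjoint f x" for c x
      by (subst vector_eq_ldot[symmetric]) (simp add: inner_adjoint[OF f, symmetric])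
    show "norm (adjoint f x) \<le> norm x * B" for x using adjoint_norm_le[OF f B \<open>0 \<le> B\<close>] by (simp add: mult.commute)
  qed
qed

lemma adjoint_add:
  fixes f g :: "'a::{real_inner, complete_space} \<Rightarrow> 'b::real_inner"
  assumes "bounded_linear f" "bounded_linear g"
  shows "adjoint (\<lambda>x. f x + g x) = (\<lambda>y. adjoint f y + adjoint g y)"
  by (rule adjoint_unique) (simp add: inner_add_left inner_add_right inner_adjoint assms)

section \<open>Finite extensions of closed subspaces\<close>

text \<open>With \<open>u\<close> the part of the new vector orthogonal to \<open>V\<close>, membership in the extension is an equation between continuous
functions: the part of \<open>x\<close> orthogonal to \<open>V\<close> is its component along \<open>u\<close>.\<close>

lemma finite_ext_closed:
  fixes W :: "'a::{real_inner, complete_space} set"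
  assumes "real_ext W V n" "subspace W" "closed W"
  shows "closed V"
  using assms(1)
proof (induction rule: finite_ext.induct)
  case refl
  show ?case by fact
next
  case (step V n b)
  have V: "closed V" "subspace V" using step real_vector.finite_ext_subspace[OF step(1) assms(2)] by auto
  define u where "u = b - orth_proj V b"
  have u: "u \<noteq> 0" using orth_proj_mem[OF V, of b] step(2) unfolding u_def by auto
  have "adjoin scaleR V b = {x. x - orth_proj V x = ((x \<bullet> u) / (u \<bullet> u)) *\<^sub>R u}"
  proof (intro subset_antisym subsetI CollectI)
    fix x assume "x \<in> adjoin scaleR V b"
    then obtain v c where x: "x = v + c *\<^sub>R b" "v \<in> V" unfolding adjoin_def by blast
    have "x - orth_proj V x = c *\<^sub>R u"
      unfolding x u_def using orth_proj_id[OF V x(2)]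
      by (simp add: linear_add[OF orth_proj_linear[OF V]] linear_scale[OF orth_proj_linear[OF V]] algebra_simps)
    moreover have "x \<bullet> u = c * (u \<bullet> u)"
    proof -
      have "x = (v + c *\<^sub>R orth_proj V b) + c *\<^sub>R u" unfolding x u_def by (simp add: algebra_simps)
      moreover have "v + c *\<^sub>R orth_proj V b \<in> V"
        using x(2) orth_proj_mem[OF V] by (intro subspace_add[OF V(2)] subspace_scale[OF V(2)])
      then have "u \<bullet> (v + c *\<^sub>R orth_proj V b) = 0" unfolding u_def by (rule orth_proj_orth[OF V])
      ultimately show ?thesis by (metis inner_commute inner_add_right inner_scaleR_right add_0)
    qed
    ultimately show "x - orth_proj V x = ((x \<bullet> u) / (u \<bullet> u)) *\<^sub>R u" using u by simp
  next
    fix x assume "x \<in> {x. x - orth_proj V x = ((x \<bullet> u) / (u \<bullet> u)) *\<^sub>R u}"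
    then have "x = (orth_proj V x - ((x \<bullet> u) / (u \<bullet> u)) *\<^sub>R orth_proj V b) + ((x \<bullet> u) / (u \<bullet> u)) *\<^sub>R b"
      unfolding u_def by (simp add: algebra_simps)
    moreover have "orth_proj V x - ((x \<bullet> u) / (u \<bullet> u)) *\<^sub>R orth_proj V b \<in> V"
      using orth_proj_mem[OF V] by (intro subspace_diff[OF V(2)] subspace_scale[OF V(2)])
    ultimately show "x \<in> adjoin scaleR V b" unfolding adjoin_def by blast
  qed
  also have "closed \<dots>"
    using u by (intro closed_Collect_eq continuous_intros linear_continuous_on orth_proj_bounded_linear V) auto
  finally show ?case .
qed

lemma finite_dim_closed:
  fixes V :: "'a::{real_inner, complete_space} set"
  shows "real_ext {0} V n \<Longrightarrow> closed V"
  by (rule finite_ext_closed) auto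

lemma finite_ext_complement:
  assumes "real_ext W V n" and W: "subspace W"
  shows "\<exists>C. real_ext {0} C n \<and> W \<inter> C = {0} \<and> W + C = V"
  using assms(1)
proof (induction rule: finite_ext.induct)
  case refl
  have "W + {0} = W" by (simp add: set_plus_def)
  then show ?case using subspace_0[OF W] finite_ext.refl[of scaleR "{0}"] by blast
next
  case (step V n b)
  then obtain C where C: "real_ext {0} C n" "W \<inter> C = {0}" "W + C = V" by blast
  have V: "subspace V" using real_vector.finite_ext_subspace[OF step(1) W] .
  have sC: "subspace C" using real_vector.finite_ext_subspace[OF C(1)] by simp
  have sub: "C \<subseteq> V" "W \<subseteq> V" using real_vector.subset_set_plus[OF W sC] C(3) by auto
  have 1: "real_ext {0} (adjoin scaleR C b) (Suc n)"
    using finite_ext.step[OF C(1)] sub step(2) by blast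
  have 2: "W \<inter> adjoin scaleR C b \<subseteq> {0}"
  proof
    fix x assume "x \<in> W \<inter> adjoin scaleR C b"
    then obtain c t where x: "x \<in> W" "x = c + t *\<^sub>R b" "c \<in> C" unfolding adjoin_def by blast
    have "t = 0"
    proof (rule ccontr)
      assume t: "t \<noteq> 0"
      then have "b = inverse t *\<^sub>R (x - c)" using x by simp
      also have "\<dots> \<in> V" using x sub by (intro subspace_scale[OF V] subspace_diff[OF V]) auto
      finally show False using step(2) by blast
    qed
    then show "x \<in> {0}" using x C(2) by auto
  qed
  have 3: "W + adjoin scaleR C b = adjoin scaleR V b"
    unfolding C(3)[symmetric] adjoin_def set_plus_def by (auto simp: add.assoc) (metis add.assoc)+
  show ?case using 1 2 3 subspace_0[OF W] real_vector.finite_ext_subset[OF 1] by blast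
qed

section \<open>Open mappings and closed ranges\<close>

lemma geometric_bound_sums:
  fixes u :: "nat \<Rightarrow> 'a::{real_normed_vector, complete_space}"
  assumes u: "\<And>k. norm (u k) \<le> c * (1/2) ^ k"
  shows "\<exists>s. u sums s \<and> norm s \<le> 2 * c"
proof -
  have gs: "(\<lambda>k. c * (1/2::real) ^ k) sums (c * 2)"
    using sums_mult[OF geometric_sums[of "1/2::real"], of c] by simp
  then have summ: "summable (\<lambda>k. c * (1/2::real) ^ k)" by (rule sums_summable)
  have le: "norm (sum u I) \<le> (\<Sum>k\<in>I. c * (1/2) ^ k)" for I
    using u by (rule sum_norm_le)
  have "Cauchy (\<lambda>n. sum u {..<n})"
  proof (rule CauchyI')
    fix e :: real assume "0 < e"
    then obtain N where N: "\<And>m n. m \<ge> N \<Longrightarrow> norm (\<Sum>k=m..<n. c * (1/2::real) ^ k) < e"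
      using summ unfolding summable_Cauchy by metis
    show "\<exists>M. \<forall>m\<ge>M. \<forall>n>m. dist (sum u {..<m}) (sum u {..<n}) < e"
      unfolding dist_norm
    proof (intro exI allI impI)
      fix m n assume mn: "m \<ge> N" "n > m"
      have "sum u {..<n} = sum u {..<m} + sum u {m..<n}"
        using mn sum.atLeastLessThan_concat[of 0 m n u] by (simp add: atLeast0LessThan)
      then have "norm (sum u {..<m} - sum u {..<n}) = norm (sum u {m..<n})" by simp
      also have "\<dots> \<le> (\<Sum>k=m..<n. c * (1/2) ^ k)" by (rule le)
      also have "\<dots> < e" using N[OF mn(1), of n] by simp
      finally show "norm (sum u {..<m} - sum u {..<n}) < e" .
    qed
  qed
  then obtain s where s: "u sums s" unfolding sums_def using Cauchy_convergent convergent_def by blast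
  have "norm s \<le> c * 2"
  proof (rule LIMSEQ_le)
    show "(\<lambda>n. norm (sum u {..<n})) \<longlonglongrightarrow> norm s" using s unfolding sums_def by (rule tendsto_norm)
    show "(\<lambda>n. \<Sum>k<n. c * (1/2) ^ k) \<longlonglongrightarrow> c * 2" using gs unfolding sums_def .
  qed (use le in blast)
  then show ?thesis using s by auto
qed

text \<open>Baire's theorem applied to the closures of the images of the balls of radius \<open>n\<close>: one of them has an interior
point. The sum of two operators is treated directly, instead of one operator on a product space, because the
applications correct a given operator \<open>T\<close> by an auxiliary \<open>Q\<close>.\<close>

lemma almost_open_estimate:
  fixes T :: "'x::real_normed_vector \<Rightarrow> 'y::{real_normed_vector, complete_space}"
    and Q :: "'z::real_normed_vector \<Rightarrow> 'y"
  assumes T: "linear T" and Q: "linear Q" and surj: "\<And>v. \<exists>x z. T x + Q z = v"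
  shows "\<exists>c>0. \<forall>v e. e > 0 \<longrightarrow> (\<exists>x z. norm x \<le> c * norm v \<and> norm z \<le> c * norm v \<and> norm (v - (T x + Q z)) \<le> e)"
proof -
  \<comment> \<open>these closed sets exhaust the space\<close>
  define A where "A n = closure {T x + Q z | x z. norm x \<le> real n \<and> norm z \<le> real n}" for n
  have "\<exists>n. interior (A n) \<noteq> {}"
  proof (rule ccontr)
    assume *: "\<not> ?thesis"
    have "euclidean interior_of (\<Union> (range A)) = {}"
    proof (rule Baire_category_alt)
      show "completely_metrizable_space (euclidean :: 'y topology) \<or>
         locally_compact_space (euclidean :: 'y topology) \<and> regular_space (euclidean :: 'y topology)"
        using completely_metrizable_space_euclidean by blast
      show "countable (range A)" by simp
      show "closedin euclidean X \<and> euclidean interior_of X = {}" if "X \<in> range A" for X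
        using that * unfolding A_def by auto
    qed
    moreover have "\<Union> (range A) = UNIV"
    proof -
      have "v \<in> \<Union> (range A)" for v
      proof -
        obtain x z where xz: "T x + Q z = v" using surj by blast
        obtain n where n: "max (norm x) (norm z) \<le> real n" using real_arch_simple by blast
        have "v \<in> A n" unfolding A_def
          by (rule subsetD[OF closure_subset]) (use xz n in auto)
        then show ?thesis by blast
      qed
      then show ?thesis by blast
    qed
    ultimately show False by simp
  qed
  then obtain n y0 where "y0 \<in> interior (A n)" by blast
  then obtain r where r: "r > 0" "ball y0 r \<subseteq> A n"
    unfolding mem_interior by blast
  \<comment> \<open>differences of two approximations near the centre \<open>y0\<close> turn the ball about \<open>y0\<close> into one about 0\<close>
  have approx: "\<exists>x z. norm x \<le> 2 * real n \<and> norm z \<le> 2 * real n \<and> norm (v - (T x + Q z)) \<le> e"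
    if v: "norm v < r" and e: "e > 0" for v e
  proof -
    have "y0 + v \<in> A n" "y0 \<in> A n" using r v by (auto simp: dist_norm)
    then obtain a b where "a \<in> {T x + Q z | x z. norm x \<le> real n \<and> norm z \<le> real n}" "dist a (y0 + v) < e / 2"
      "b \<in> {T x + Q z | x z. norm x \<le> real n \<and> norm z \<le> real n}" "dist b y0 < e / 2"
      unfolding A_def closure_approachable using e by (metis (no_types, lifting) half_gt_zero)
    then obtain x z x' z' where xz: "norm x \<le> real n" "norm z \<le> real n" "norm x' \<le> real n" "norm z' \<le> real n"
      and d: "norm (T x + Q z - (y0 + v)) < e / 2" "norm (T x' + Q z' - y0) < e / 2"
      by (auto simp: dist_norm)
    have "v - (T (x - x') + Q (z - z')) = (T x' + Q z' - y0) - (T x + Q z - (y0 + v))"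
      by (simp add: linear_diff[OF T] linear_diff[OF Q])
    then have "norm (v - (T (x - x') + Q (z - z'))) \<le> norm (T x' + Q z' - y0) + norm (T x + Q z - (y0 + v))"
      by (metis norm_triangle_ineq4)
    then have "norm (v - (T (x - x') + Q (z - z'))) \<le> e" using d by linarith
    moreover have "norm (x - x') \<le> 2 * real n" "norm (z - z') \<le> 2 * real n"
      using xz norm_triangle_ineq4[of x x'] norm_triangle_ineq4[of z z'] by linarith+
    ultimately show ?thesis by blast
  qed
  define c where "c = 4 * (real n + 1) / r"
  have c: "c > 0" unfolding c_def using r(1) by simp
  have "\<exists>x z. norm x \<le> c * norm v \<and> norm z \<le> c * norm v \<and> norm (v - (T x + Q z)) \<le> e" if e: "e > 0" for v e
  proof (cases "v = 0")
    case True
    then show ?thesis using e by (intro exI[of _ 0]) (simp add: linear_0[OF T] linear_0[OF Q])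
  next
    case False
    define s where "s = r / (2 * norm v)"
    have s: "s > 0" unfolding s_def using False r(1) by simp
    have "norm (s *\<^sub>R v) < r" unfolding s_def using False r(1) by simp
    then obtain x z where xz: "norm x \<le> 2 * real n" "norm z \<le> 2 * real n"
      "norm (s *\<^sub>R v - (T x + Q z)) \<le> s * e"
      using approx[of "s *\<^sub>R v" "s * e"] s e by auto
    have cs: "c * norm v = inverse s * (2 * (real n + 1))" unfolding c_def s_def using False r(1) by (simp add: field_simps)
    have b: "norm (inverse s *\<^sub>R x) \<le> c * norm v" "norm (inverse s *\<^sub>R z) \<le> c * norm v"
      unfolding cs using xz(1,2) s by (simp_all add: divide_simps)
    have "v - (T (inverse s *\<^sub>R x) + Q (inverse s *\<^sub>R z)) = inverse s *\<^sub>R (s *\<^sub>R v - (T x + Q z))"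
      using s by (simp add: linear_scale[OF T] linear_scale[OF Q] algebra_simps)
    then have "norm (v - (T (inverse s *\<^sub>R x) + Q (inverse s *\<^sub>R z))) = inverse s * norm (s *\<^sub>R v - (T x + Q z))"
      using s by simp
    also have "\<dots> \<le> inverse s * (s * e)" using xz(3) s by (intro mult_left_mono) auto
    also have "\<dots> = e" using s by simp
    finally show ?thesis using b by (intro exI[of _ "inverse s *\<^sub>R x"] exI[of _ "inverse s *\<^sub>R z"] conjI)
  qed
  then show ?thesis using c by blast
qed

text \<open>Successive approximation: each step halves the error, so that the corrections form convergent series.\<close>

lemma open_mapping:
  fixes T :: "'x::{real_normed_vector, complete_space} \<Rightarrow> 'y::{real_normed_vector, complete_space}"
    and Q :: "'z::{real_normed_vector, complete_space} \<Rightarrow> 'y"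
  assumes T: "bounded_linear T" and Q: "bounded_linear Q" and surj: "\<And>v. \<exists>x z. T x + Q z = v"
  shows "\<exists>c>0. \<forall>v. \<exists>x z. T x + Q z = v \<and> norm x \<le> c * norm v \<and> norm z \<le> c * norm v"
proof -
  have lT: "linear T" and lQ: "linear Q" using T Q by (auto intro: bounded_linear.linear)
  obtain c where c: "c > 0" and ap: "\<And>v e. e > 0 \<Longrightarrow>
      \<exists>x z. norm x \<le> c * norm v \<and> norm z \<le> c * norm v \<and> norm (v - (T x + Q z)) \<le> e"
    using almost_open_estimate[OF lT lQ surj] by blast
  have "\<exists>x z. norm x \<le> c * norm v \<and> norm z \<le> c * norm v \<and> norm (v - (T x + Q z)) \<le> norm v / 2" for v
  proof (cases "v = 0")
    case True
    then show ?thesis by (intro exI[of _ 0]) (simp add: linear_0[OF lT] linear_0[OF lQ])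
  next
    case False
    then show ?thesis using ap[of "norm v / 2" v] by simp
  qed
  then obtain f g where fg: "\<And>v. norm (f v) \<le> c * norm v" "\<And>v. norm (g v) \<le> c * norm v"
    "\<And>v. norm (v - (T (f v) + Q (g v))) \<le> norm v / 2" by metis
  have "\<exists>x z. T x + Q z = v \<and> norm x \<le> 2 * c * norm v \<and> norm z \<le> 2 * c * norm v" for v
  proof -
    \<comment> \<open>the remainder after \<open>k\<close> steps\<close>
    define r where "r = rec_nat v (\<lambda>_ w. w - (T (f w) + Q (g w)))"
    have r0: "r 0 = v" and rS: "\<And>k. r (Suc k) = r k - (T (f (r k)) + Q (g (r k)))" unfolding r_def by auto
    have rb: "norm (r k) \<le> norm v * (1/2) ^ k" for k
    proof (induction k)
      case (Suc k)
      have "norm (r (Suc k)) \<le> norm (r k) / 2" unfolding rS by (rule fg(3))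
      with Suc show ?case by simp
    qed (simp add: r0)
    have "norm (f (r k)) \<le> c * norm v * (1/2) ^ k" "norm (g (r k)) \<le> c * norm v * (1/2) ^ k" for k
      using order_trans[OF fg(1), of "r k"] order_trans[OF fg(2), of "r k"] mult_left_mono[OF rb, of c k] c
      by (auto simp: mult.assoc)
    then obtain x z where x: "(\<lambda>k. f (r k)) sums x" "norm x \<le> 2 * (c * norm v)"
      and z: "(\<lambda>k. g (r k)) sums z" "norm z \<le> 2 * (c * norm v)"
      using geometric_bound_sums[of "\<lambda>k. f (r k)" "c * norm v"] geometric_bound_sums[of "\<lambda>k. g (r k)" "c * norm v"] by blast
    have "(\<lambda>k. T (f (r k)) + Q (g (r k))) sums (T x + Q z)"
      by (intro sums_add bounded_linear.sums[OF T] bounded_linear.sums[OF Q] x z)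
    moreover have "(\<lambda>k. T (f (r k)) + Q (g (r k))) = (\<lambda>k. r k - r (Suc k))" using rS by auto
    moreover have "(\<lambda>k. r k - r (Suc k)) sums (r 0 - 0)"
    proof (rule telescope_sums')
      have "(\<lambda>k. norm v * (1/2::real) ^ k) \<longlonglongrightarrow> norm v * 0"
        by (intro tendsto_intros LIMSEQ_power_zero) simp
      then have lim: "(\<lambda>k. norm v * (1/2::real) ^ k) \<longlonglongrightarrow> 0" by simp
      show "r \<longlonglongrightarrow> 0"
        by (rule Lim_null_comparison[OF _ lim]) (intro always_eventually allI rb)
    qed
    ultimately have "T x + Q z = r 0 - 0" by (metis sums_unique2)
    then have "T x + Q z = v" by (simp add: r0)
    then show ?thesis using x z by (auto simp: mult.assoc)
  qed
  then show ?thesis using c by (intro exI[of _ "2 * c"]) auto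
qed

text \<open>An operator range with an operator range as algebraic complement is closed. If \<open>T x\<^sub>n\<close> tends to \<open>l = T u + Q z\<close>,
bounded preimages of \<open>l - T x\<^sub>n\<close> under \<open>(x, z) \<mapsto> T x + Q z\<close> have second components with \<open>Q\<close>-value \<open>Q z\<close>, by uniqueness of
the decomposition. These tend to 0, hence \<open>Q z = 0\<close>.\<close>

lemma complemented_range_closed:
  fixes T :: "'x::{real_normed_vector, complete_space} \<Rightarrow> 'y::{real_normed_vector, complete_space}"
    and Q :: "'z::{real_normed_vector, complete_space} \<Rightarrow> 'y"
  assumes T: "bounded_linear T" and Q: "bounded_linear Q" and surj: "\<And>v. \<exists>x z. T x + Q z = v"
    and disj: "range T \<inter> range Q \<subseteq> {0}"
  shows "closed (range T)" "\<exists>c>0. \<forall>y\<in>range T. \<exists>x. T x = y \<and> norm x \<le> c * norm y"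
proof -
  have lT: "linear T" and lQ: "linear Q" using T Q by (auto intro: bounded_linear.linear)
  obtain c where c: "c > 0" and lift: "\<And>v. \<exists>x z. T x + Q z = v \<and> norm x \<le> c * norm v \<and> norm z \<le> c * norm v"
    using open_mapping[OF T Q surj] by blast
  have split: "Q z = Q z'" "T x = T x'" if "T x + Q z = T x' + Q z'" for x x' z z'
  proof -
    have "T (x - x') = Q (z' - z)" using that by (simp add: linear_diff[OF lT] linear_diff[OF lQ] algebra_simps)
    then have "T (x - x') = 0" using disj by (metis IntI rangeI singletonD subsetD)
    then show "T x = T x'" by (simp add: linear_diff[OF lT])
    then show "Q z = Q z'" using that by simp
  qed
  have "\<exists>x. T x = y \<and> norm x \<le> c * norm y" if y: "y \<in> range T" for y
  proof -
    obtain u where u: "y = T u" using y by blast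
    obtain x z where xz: "T x + Q z = y" "norm x \<le> c * norm y" using lift by blast
    have "T x + Q z = T u + Q 0" using xz u linear_0[OF lQ] by simp
    then have "T x = y" using split(2) u by blast
    then show ?thesis using xz by blast
  qed
  then show "\<exists>c>0. \<forall>y\<in>range T. \<exists>x. T x = y \<and> norm x \<le> c * norm y" using c by blast
  obtain K where K: "K \<ge> 0" "\<And>z. norm (Q z) \<le> norm z * K" using bounded_linear.nonneg_bounded[OF Q] by blast
  show "closed (range T)"
    unfolding closed_sequential_limits
  proof (intro allI impI, elim conjE)
    fix y l assume y: "\<forall>n. y n \<in> range T" and lim: "y \<longlonglongrightarrow> l"
    obtain u0 z0 where 0: "T u0 + Q z0 = l" using surj by blast
    have b: "norm (Q z0) \<le> (c * K) * norm (l - y n)" for n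
    proof -
      obtain u where u: "y n = T u" using y by blast
      obtain x z where xz: "T x + Q z = l - y n" "norm z \<le> c * norm (l - y n)" using lift by blast
      have "T (x + u) + Q z = T u0 + Q z0" using xz(1) 0 u by (simp add: linear_add[OF lT] algebra_simps)
      then have "Q z0 = Q z" using split(1) by metis
      then have "norm (Q z0) \<le> norm z * K" using K by simp
      also have "\<dots> \<le> (c * norm (l - y n)) * K" using xz(2) K(1) by (rule mult_right_mono)
      finally show ?thesis by (simp add: ac_simps)
    qed
    have "(\<lambda>n. (c * K) * norm (l - y n)) \<longlonglongrightarrow> (c * K) * norm (l - l)" by (intro tendsto_intros lim)
    then have "norm (Q z0) \<le> (c * K) * norm (l - l)" using b by (intro LIMSEQ_le_const) auto
    then have "Q z0 = 0" by simp
    then show "l \<in> range T" using 0 by auto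
  qed
qed

text \<open>Apply the previous lemma with \<open>Q\<close> an operator whose range is the sum of an algebraic complement \<open>C\<close> of
the range in \<open>N\<close> and the orthogonal complement of \<open>N\<close>.\<close>

lemma finite_codim_range_closed:
  fixes T :: "'b::{real_inner, complete_space} \<Rightarrow> 'a::{real_inner, complete_space}"
  assumes T: "bounded_linear T" and N: "closed N" "subspace N" and ext: "real_ext (range T) N n"
  shows "closed (range T)" "\<exists>c>0. \<forall>y\<in>range T. \<exists>x. T x = y \<and> norm x \<le> c * norm y"
proof -
  have lT: "linear T" using T by (rule bounded_linear.linear)
  note sR = range_subspace[OF lT]
  obtain C where C: "real_ext {0} C n" "range T \<inter> C = {0}" "range T + C = N"
    using finite_ext_complement[OF ext sR] by blast
  have sC: "subspace C" using real_vector.finite_ext_subspace[OF C(1)] by simp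
  have cC: "closed C" using finite_dim_closed[OF C(1)] .
  have sub: "C \<subseteq> N" "range T \<subseteq> N" using real_vector.subset_set_plus[OF sR sC] C(3) by auto
  define Q where "Q z = orth_proj C z + (z - orth_proj N z)" for z
  have Q: "bounded_linear Q" unfolding Q_def
    by (intro bounded_linear_add bounded_linear_sub bounded_linear_ident orth_proj_bounded_linear cC sC N)
  have surj: "\<exists>x z. T x + Q z = v" for v
  proof -
    obtain u c where uc: "orth_proj N v = T u + c" "c \<in> C"
      using orth_proj_mem[OF N, of v] C(3) by (auto elim!: set_plus_elim)
    define z where "z = c + (v - orth_proj N v)"
    have o: "(v - orth_proj N v) \<bullet> m = 0" if "m \<in> N" for m using orth_proj_orth[OF N that] .
    have "orth_proj C z = c" unfolding z_def using uc(2) o sub by (intro orth_proj_unique[OF cC sC]) auto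
    moreover have "orth_proj N z = c" unfolding z_def using uc(2) o sub by (intro orth_proj_unique[OF N]) auto
    ultimately have "T u + Q z = v" unfolding Q_def using uc(1) by (simp add: z_def)
    then show ?thesis by blast
  qed
  have disj: "range T \<inter> range Q \<subseteq> {0}"
  proof
    fix y assume "y \<in> range T \<inter> range Q"
    then obtain u z where y: "y = T u" "y = orth_proj C z + (z - orth_proj N z)" unfolding Q_def by blast
    have "z - orth_proj N z = y - orth_proj C z" using y(2) by simp
    then have "z - orth_proj N z \<in> N" using y(1) sub orth_proj_mem[OF cC sC, of z] by (auto intro!: subspace_diff[OF N(2)])
    then have "(z - orth_proj N z) \<bullet> (z - orth_proj N z) = 0" by (rule orth_proj_orth[OF N])
    then have "y \<in> C" using y(2) orth_proj_mem[OF cC sC, of z] by simp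
    then show "y \<in> {0}" using y(1) C(2) by blast
  qed
  show "closed (range T)" "\<exists>c>0. \<forall>y\<in>range T. \<exists>x. T x = y \<and> norm x \<le> c * norm y"
    using complemented_range_closed[OF T Q surj disj] by auto
qed

text \<open>\<open>W v\<close> is the preimage of the projection of \<open>v\<close> that is orthogonal to the kernel. Being unique, it depends linearly on \<open>v\<close>.\<close>

lemma bounded_generalized_inverse:
  fixes T :: "'b::{real_inner, complete_space} \<Rightarrow> 'a::{real_inner, complete_space}"
  assumes T: "bounded_linear T" and cl: "closed (range T)"
    and lift: "\<exists>c>0. \<forall>y\<in>range T. \<exists>x. T x = y \<and> norm x \<le> c * norm y"
  shows "\<exists>W. bounded_linear W \<and> (\<forall>v. T (W v) = orth_proj (range T) v)"
proof -
  have lT: "linear T" using T by (rule bounded_linear.linear)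
  note R = cl range_subspace[OF lT]
  note N = closed_null_space[OF T] null_space_subspace[OF lT]
  let ?N = "null_space T" and ?P = "orth_proj (range T)"
  obtain c where c: "c > 0" "\<And>y. y \<in> range T \<Longrightarrow> \<exists>x. T x = y \<and> norm x \<le> c * norm y" using lift by blast
  have "\<exists>x. T x = ?P v \<and> (\<forall>n\<in>?N. x \<bullet> n = 0) \<and> norm x \<le> c * norm v" for v
  proof -
    obtain x where x: "T x = ?P v" "norm x \<le> c * norm (?P v)" using c(2)[OF orth_proj_mem[OF R]] by blast
    have "T (orth_proj ?N x) = 0" using orth_proj_mem[OF N, of x] by (simp add: null_space_def)
    then have "T (x - orth_proj ?N x) = ?P v" using x(1) by (simp add: linear_diff[OF lT])
    moreover have "norm (x - orth_proj ?N x) \<le> c * norm v"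
      using norm_diff_orth_proj_le[OF N, of x] x(2) mult_left_mono[OF norm_orth_proj_le[OF R, of v], of c] c(1) by linarith
    ultimately show ?thesis using orth_proj_orth[OF N] by blast
  qed
  then obtain W where W: "\<And>v. T (W v) = ?P v" "\<And>v n. n \<in> ?N \<Longrightarrow> W v \<bullet> n = 0" "\<And>v. norm (W v) \<le> c * norm v"
    by metis
  have uniq: "x = y" if "T x = T y" "\<And>n. n \<in> ?N \<Longrightarrow> x \<bullet> n = 0" "\<And>n. n \<in> ?N \<Longrightarrow> y \<bullet> n = 0" for x y
  proof -
    have "x - y \<in> ?N" using that(1) by (simp add: null_space_def linear_diff[OF lT])
    then have "(x - y) \<bullet> (x - y) = 0" using that(2,3) by (simp add: inner_diff_left)
    then show ?thesis by simp
  qed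
  have "bounded_linear W"
  proof (rule bounded_linear_intro[of _ c])
    show "W (x + y) = W x + W y" for x y
      by (rule uniq) (auto simp: W linear_add[OF lT] linear_add[OF orth_proj_linear[OF R]] inner_add_left)
    show "W (a *\<^sub>R x) = a *\<^sub>R W x" for a x
      by (rule uniq) (auto simp: W linear_scale[OF lT] linear_scale[OF orth_proj_linear[OF R]])
    show "norm (W x) \<le> norm x * c" for x using W(3)[of x] by (simp add: mult.commute)
  qed
  then show ?thesis using W(1) by blast
qed

section \<open>Small and compact operators\<close>

text \<open>Solving \<open>x + L x = y\<close> means to find a fixed point of the contraction \<open>x \<mapsto> y - L x\<close>.\<close>

lemma bij_identity_plus_contraction:
  fixes L :: "'a::{real_normed_vector, complete_space} \<Rightarrow> 'a"
  assumes L: "linear L" and q: "0 \<le> q" "q < 1" "\<And>x. norm (L x) \<le> q * norm x"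
  shows "bij (\<lambda>x. x + L x)"
proof (rule bijI')
  show "\<exists>x. y = x + L x" for y
  proof -
    have "\<exists>!x. y - L x = x"
    proof (rule banach_fix_type[OF q(1,2)], intro allI)
      fix x z
      have "dist (y - L x) (y - L z) = norm (L (z - x))" by (simp add: dist_norm linear_diff[OF L])
      also have "\<dots> \<le> q * norm (z - x)" by (rule q(3))
      finally show "dist (y - L x) (y - L z) \<le> q * dist x z" by (simp add: dist_norm norm_minus_commute)
    qed
    then obtain x where "y - L x = x" by blast
    then have "y = x + L x" by (simp add: algebra_simps)
    then show ?thesis by blast
  qed
  show "(x + L x = y + L y) = (x = y)" for x y
  proof
    assume "x + L x = y + L y"
    then have "x - y = - L (x - y)" by (simp add: linear_diff[OF L] algebra_simps)
    then have "norm (x - y) \<le> q * norm (x - y)" using q(3)[of "x - y"] by (metis norm_minus_cancel)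
    then have "(1 - q) * norm (x - y) \<le> 0" by (simp add: algebra_simps)
    then show "x = y" using q(2) by (simp add: mult_le_0_iff)
  qed simp
qed

text \<open>Project onto the span of a finite \<open>e\<close>-net for the image of the unit ball.\<close>

lemma compact_finite_rank_approx:
  fixes K :: "'a::real_normed_vector \<Rightarrow> 'b::{real_inner, complete_space}"
  assumes K: "linear K" and cpt: "compact (closure (K ` cball 0 1))" and e: "e > 0"
  shows "\<exists>Y n. real_ext {0} Y n \<and> (\<forall>x. norm (K x - orth_proj Y (K x)) \<le> e * norm x)"
proof -
  obtain k where k: "finite k" "closure (K ` cball 0 1) \<subseteq> (\<Union>y\<in>k. ball y e)"
    using cpt e unfolding compact_eq_totally_bounded by blast
  obtain n where n: "real_ext {0} (span k) n" using real_vector.finite_ext_span[OF k(1)] by blast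
  note Y = finite_dim_closed[OF n] subspace_span[of k]
  have unit: "norm (K x - orth_proj (span k) (K x)) \<le> e" if "norm x \<le> 1" for x
  proof -
    have "K x \<in> closure (K ` cball 0 1)" using that by (intro subsetD[OF closure_subset]) auto
    then obtain y where y: "y \<in> k" "dist y (K x) < e" using k(2) by auto
    have "norm (K x - orth_proj (span k) (K x)) \<le> norm (K x - y)"
      by (rule norm_diff_orth_proj_le_dist[OF Y span_base[OF y(1)]])
    then show ?thesis using y(2) by (simp add: dist_norm norm_minus_commute)
  qed
  have "norm (K x - orth_proj (span k) (K x)) \<le> e * norm x" for x
  proof (cases "x = 0")
    case True
    then show ?thesis using linear_0[OF K] orth_proj_id[OF Y, of 0] by (simp add: span_zero)
  next
    case False
    define u where "u = inverse (norm x) *\<^sub>R x"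
    have x: "x = norm x *\<^sub>R u" and u: "norm u \<le> 1" unfolding u_def using False by auto
    have "K x - orth_proj (span k) (K x) = norm x *\<^sub>R (K u - orth_proj (span k) (K u))"
      by (subst (1 2) x) (simp add: linear_scale[OF K] linear_scale[OF orth_proj_linear[OF Y]] scaleR_diff_right)
    then have "norm (K x - orth_proj (span k) (K x)) = norm x * norm (K u - orth_proj (span k) (K u))" by simp
    also have "\<dots> \<le> norm x * e" using unit[OF u] by (intro mult_left_mono) auto
    finally show ?thesis by (simp add: mult.commute)
  qed
  then show ?thesis using n by blast
qed

section \<open>Fredholm operators\<close>

lemma null_space_zero: "null_space (\<lambda>_. 0) = UNIV" and range_zero: "range (\<lambda>_. 0) = {0}"
  by (auto simp: null_space_def)

lemma fredholmI:
  fixes V :: "'a::real_normed_vector \<Rightarrow> 'b::real_normed_vector"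
  assumes V: "linear V" and "real_ext {0} (null_space V) n" "real_ext (range V) UNIV m"
  shows "commensurable_pair V (\<lambda>_. 0)" "pair_index V (\<lambda>_. 0) = int n - int m"
proof -
  note a = commensurableI[OF subspace_single_0 assms(2) finite_ext.refl]
  note b = commensurableI[OF range_subspace[OF V] assms(3) finite_ext.refl]
  show "commensurable_pair V (\<lambda>_. 0)" "pair_index V (\<lambda>_. 0) = int n - int m"
    unfolding commensurable_pair_def pair_index_eq_relative_dim null_space_zero range_zero using a b by auto
qed

lemma fredholmE:
  fixes V :: "'a::real_normed_vector \<Rightarrow> 'b::real_normed_vector"
  assumes V: "linear V" and "commensurable_pair V (\<lambda>_. 0)"
  obtains n m where "real_ext {0} (null_space V) n" "real_ext (range V) UNIV m"
    "pair_index V (\<lambda>_. 0) = int n - int m"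
proof -
  have c: "commensurable (null_space V) {0}" "commensurable UNIV (range V)"
    using assms(2) unfolding commensurable_pair_def null_space_zero range_zero by auto
  have "null_space V \<inter> {0} = {0}" using subspace_0[OF null_space_subspace[OF V]] by auto
  then obtain n where "real_ext {0} (null_space V) n" using commensurableE[OF c(1)] by metis
  moreover obtain m where "real_ext (range V) UNIV m" using commensurableE[OF c(2)] by (metis Int_UNIV_left)
  ultimately show ?thesis using that fredholmI[OF V] by blast
qed

text \<open>Let \<open>W\<close> be a generalized inverse of \<open>V\<close>. If \<open>G\<close> is small, then \<open>J = I + W G\<close> is bijective, so \<open>V J\<close> has the same range as
\<open>V\<close> and a kernel of the same dimension. Since \<open>V W\<close> is the projection onto the range of \<open>V\<close>, the operators \<open>V + G\<close>
and \<open>V J = V + V W G\<close> agree wherever \<open>G\<close> takes values in that range, which is a subspace of finite codimension.\<close>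

lemma fredholm_small_perturbation:
  fixes V :: "'a::{real_inner, complete_space} \<Rightarrow> 'b::{real_inner, complete_space}"
  assumes V: "bounded_linear V" and F: "commensurable_pair V (\<lambda>_. 0)"
  shows "\<exists>e>0. \<forall>G. bounded_linear G \<longrightarrow> (\<forall>x. norm (G x) \<le> e * norm x) \<longrightarrow>
    commensurable_pair (\<lambda>x. V x + G x) (\<lambda>_. 0) \<and> pair_index (\<lambda>x. V x + G x) (\<lambda>_. 0) = pair_index V (\<lambda>_. 0)"
proof -
  have lV: "linear V" using V by (rule bounded_linear.linear)
  obtain n m where nm: "real_ext {0} (null_space V) n" "real_ext (range V) UNIV m"
    "pair_index V (\<lambda>_. 0) = int n - int m" using fredholmE[OF lV F] by blast
  note sR = range_subspace[OF lV]
  obtain W where W: "bounded_linear W" "\<And>v. V (W v) = orth_proj (range V) v"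
    using bounded_generalized_inverse[OF V finite_codim_range_closed[OF V closed_UNIV subspace_UNIV nm(2)]] by blast
  have cR: "closed (range V)" using finite_codim_range_closed(1)[OF V closed_UNIV subspace_UNIV nm(2)] .
  obtain B where B: "B \<ge> 0" "\<And>v. norm (W v) \<le> norm v * B" using bounded_linear.nonneg_bounded[OF W(1)] by blast
  \<comment> \<open>makes \<open>W G\<close> a contraction with factor \<open>1/2\<close>; the summand 1 covers the case \<open>B = 0\<close>\<close>
  define e where "e = 1 / (2 * (B + 1))"
  have e: "e > 0" "e * B \<le> 1 / 2" unfolding e_def using B(1) by (auto simp: field_simps)
  have "commensurable_pair (\<lambda>x. V x + G x) (\<lambda>_. 0) \<and> pair_index (\<lambda>x. V x + G x) (\<lambda>_. 0) = pair_index V (\<lambda>_. 0)"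
    if G: "bounded_linear G" and small: "\<And>x. norm (G x) \<le> e * norm x" for G
  proof -
    have lG: "linear G" using G by (rule bounded_linear.linear)
    have lWG: "linear (\<lambda>x. W (G x))"
      using linear_compose[OF lG bounded_linear.linear[OF W(1)]] by (simp add: o_def)
    define J where "J x = x + W (G x)" for x
    have lJ: "linear J" unfolding J_def by (intro linear_compose_add lWG linear_id[unfolded id_def])
    have "norm (W (G x)) \<le> (1/2) * norm x" for x
    proof -
      have "norm (W (G x)) \<le> norm (G x) * B" by (rule B(2))
      also have "\<dots> \<le> (e * norm x) * B" using small B(1) by (rule mult_right_mono)
      also have "\<dots> = (e * B) * norm x" by simp
      also have "\<dots> \<le> (1/2) * norm x" using e(2) by (rule mult_right_mono) simp
      finally show ?thesis .
    qed
    then have bJ: "bij J" unfolding J_def by (intro bij_identity_plus_contraction[OF lWG, of "1/2"]) auto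
    define VJ where "VJ x = V (J x)" for x
    have lVJ: "linear VJ" unfolding VJ_def using linear_compose[OF lJ lV] by (simp add: o_def)
    have "real_ext (J -` {0}) (J -` null_space V) n"
      using finite_ext_vimage_range[OF lJ nm(1)] bij_is_surj[OF bJ] by auto
    moreover have "J -` {0} = {0}" using injD[OF bij_is_inj[OF bJ], of _ 0] linear_0[OF lJ] by auto
    moreover have "J -` null_space V = null_space VJ" unfolding VJ_def null_space_def by auto
    ultimately have N: "real_ext {0} (null_space VJ) n" by simp
    have "range VJ = V ` range J" unfolding VJ_def by auto
    then have R: "real_ext (range VJ) UNIV m" using nm(2) bij_is_surj[OF bJ] by simp
    note VJ = fredholmI[OF lVJ N R]
    obtain k where "real_ext (G -` range V) (G -` UNIV) k" using finite_ext_vimage[OF lG nm(2) sR] by blast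
    moreover have "VJ x = V x + G x" if "x \<in> G -` range V" for x
      using that orth_proj_id[OF cR sR] unfolding VJ_def J_def by (simp add: linear_add[OF lV] W(2))
    moreover have "subspace (G -` range V)" using linear_subspace_vimage[OF lG sR] .
    ultimately have "VJ \<simeq> (\<lambda>x. V x + G x)" unfolding eq_upto_finite_rank_def by auto
    moreover have "linear (\<lambda>x. V x + G x)" by (intro linear_compose_add lV lG)
    ultimately show ?thesis using commensurable_pair_cong_left[OF lVJ _ _ VJ(1)] VJ(2) nm(3) by metis
  qed
  then show ?thesis using e(1) by blast
qed

section \<open>Pairs with zero products\<close>

text \<open>Let \<open>V = S + T\<^sup>*\<close>. As \<open>T S = 0\<close>, the ranges of \<open>S\<close> and \<open>T\<^sup>*\<close> are orthogonal. So the kernel of \<open>V\<close> is the intersection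
of \<open>N(S)\<close> with the orthogonal complement of \<open>R(T)\<close>, which is a model of \<open>N(S)/R(T)\<close>, and the range of \<open>V\<close> consists of
\<open>R(S)\<close> and \<open>R(T\<^sup>*) = N(T)\<^sup>\<bottom>\<close>, which leaves \<open>N(T)/R(S)\<close> as cokernel.\<close>

lemma square_zero_pair_fredholm:
  fixes S :: "'a::{real_inner, complete_space} \<Rightarrow> 'b::{real_inner, complete_space}" and T :: "'b \<Rightarrow> 'a"
  assumes S: "bounded_linear S" and T: "bounded_linear T"
    and ST: "\<And>y. S (T y) = 0" and TS: "\<And>x. T (S x) = 0" and fp: "commensurable_pair S T"
  shows "commensurable_pair (\<lambda>x. S x + adjoint T x) (\<lambda>_. 0)"
    "pair_index (\<lambda>x. S x + adjoint T x) (\<lambda>_. 0) = pair_index S T"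
proof -
  have lS: "linear S" and lT: "linear T" using S T by (auto intro: bounded_linear.linear)
  note NS = closed_null_space[OF S] null_space_subspace[OF lS]
  note NT = closed_null_space[OF T] null_space_subspace[OF lT]
  note sRS = range_subspace[OF lS] and sRT = range_subspace[OF lT]
  have sub: "range T \<subseteq> null_space S" "range S \<subseteq> null_space T" using ST TS by (auto simp: null_space_def)
  define V where "V x = S x + adjoint T x" for x
  have lV: "linear V" unfolding V_def
    by (intro linear_compose_add lS bounded_linear.linear[OF adjoint_bounded_linear[OF T]])
  have adj: "T y \<bullet> x = y \<bullet> adjoint T x" for x y using inner_adjoint[OF T] .
  have c: "commensurable (null_space S) (range T)" "commensurable (null_space T) (range S)"
    using fp unfolding commensurable_pair_def by auto
  obtain n where n: "real_ext (range T) (null_space S) n"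
    using commensurableE[OF c(1)] sub by (metis inf.absorb2)
  obtain m where m: "real_ext (range S) (null_space T) m"
    using commensurableE[OF c(2)] sub by (metis inf.absorb2)
  have ind: "pair_index S T = int n - int m"
    unfolding pair_index_eq_relative_dim
    using commensurableI(2)[OF sRT n finite_ext.refl] commensurableI(2)[OF sRS m finite_ext.refl] by simp
  note clT = finite_codim_range_closed[OF T NS n]
  note RT = clT(1) sRT
  have NV: "null_space V = {x \<in> null_space S. \<forall>y. T y \<bullet> x = 0}"
  proof (intro subset_antisym subsetI)
    fix x assume "x \<in> null_space V"
    then have 0: "S x = - adjoint T x" unfolding null_space_def V_def by (simp add: eq_neg_iff_add_eq_0)
    have "S x \<bullet> S x = - (S x \<bullet> adjoint T x)" by (subst (2) 0) simp
    also have "\<dots> = 0" using adj[of "S x" x] TS by simp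
    finally have "S x = 0" by simp
    then show "x \<in> {x \<in> null_space S. \<forall>y. T y \<bullet> x = 0}" using 0 adj by (simp add: null_space_def)
  next
    fix x assume x: "x \<in> {x \<in> null_space S. \<forall>y. T y \<bullet> x = 0}"
    then have "\<forall>y. y \<bullet> adjoint T x = y \<bullet> 0" using adj by simp
    then have "adjoint T x = 0" by (simp only: vector_eq_ldot)
    then show "x \<in> null_space V" using x by (simp add: null_space_def V_def)
  qed
  note sNV = null_space_subspace[OF lV]
  have NVS: "null_space V \<subseteq> null_space S" using NV by auto
  have kernel: "real_ext {0} (null_space V) n"
  proof -
    obtain k l where kl: "real_ext (range T \<inter> null_space V) (null_space S \<inter> null_space V) k"
      "real_ext (range T + null_space V) (null_space S + null_space V) l" "k + l = n"
      using real_vector.finite_ext_modular[OF n sRT sNV] by blast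
    have 1: "range T \<inter> null_space V = {0}"
    proof
      show "{0} \<subseteq> range T \<inter> null_space V" using subspace_0[OF sRT] subspace_0[OF sNV] by simp
      show "range T \<inter> null_space V \<subseteq> {0}"
      proof
        fix x assume "x \<in> range T \<inter> null_space V"
        then obtain y where "x = T y" "\<forall>y. T y \<bullet> x = 0" unfolding NV by blast
        then have "x \<bullet> x = 0" by metis
        then show "x \<in> {0}" by simp
      qed
    qed
    have 2: "null_space S \<inter> null_space V = null_space V" using NVS by blast
    have 3: "null_space S + null_space V = null_space S" using real_vector.set_plus_absorb[OF NS(2) sNV NVS] .
    have 4: "range T + null_space V = null_space S"
    proof
      show "range T + null_space V \<subseteq> null_space S" using real_vector.set_plus_least[OF NS(2) sub(1) NVS] .
      show "null_space S \<subseteq> range T + null_space V"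
      proof
        fix x assume x: "x \<in> null_space S"
        have "x - orth_proj (range T) x \<in> null_space S"
          using x sub(1) orth_proj_mem[OF RT, of x] by (intro subspace_diff[OF NS(2)]) auto
        then have "x - orth_proj (range T) x \<in> null_space V"
          unfolding NV using orth_proj_orth[OF RT, of _ x] by (auto simp: inner_commute)
        from set_plus_intro[OF orth_proj_mem[OF RT, of x] this] show "x \<in> range T + null_space V" by simp
      qed
    qed
    have "l = 0" using real_vector.finite_ext_unique[OF NS(2) kl(2)[unfolded 3 4] finite_ext.refl] .
    then show ?thesis using kl 1 2 by simp
  qed
  obtain W where W: "bounded_linear W" "\<And>v. T (W v) = orth_proj (range T) v"
    using bounded_generalized_inverse[OF T clT] by blast
  have onto: "z \<in> range V" if z: "\<And>u. u \<in> null_space T \<Longrightarrow> u \<bullet> z = 0" for z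
  proof -
    \<comment> \<open>\<open>W\<^sup>*\<close> inverts \<open>T\<^sup>*\<close> on the complement of \<open>N(T)\<close>; the projection puts \<open>x\<close> into \<open>R(T)\<close>, where \<open>S\<close> vanishes\<close>
    define x where "x = orth_proj (range T) (adjoint W z)"
    have "u \<bullet> adjoint T x = u \<bullet> z" for u
    proof -
      have "u \<bullet> adjoint T x = T u \<bullet> x" using adj by simp
      also have "\<dots> = T u \<bullet> adjoint W z"
        unfolding x_def orth_proj_selfadjoint[OF RT, symmetric] using orth_proj_id[OF RT, of "T u"] by simp
      also have "\<dots> = W (T u) \<bullet> z" using inner_adjoint[OF W(1)] by simp
      also have "\<dots> = u \<bullet> z"
      proof -
        have "T (W (T u) - u) = 0" using W(2)[of "T u"] orth_proj_id[OF RT, of "T u"] by (simp add: linear_diff[OF lT])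
        then have "(W (T u) - u) \<bullet> z = 0" by (intro z) (simp add: null_space_def)
        then show ?thesis by (simp add: inner_diff_left)
      qed
      finally show ?thesis .
    qed
    then have "adjoint T x = z" using vector_eq_ldot by blast
    moreover have "S x = 0" using orth_proj_mem[OF RT] sub(1) unfolding x_def null_space_def by auto
    ultimately have "V x = z" by (simp add: V_def)
    then show ?thesis by auto
  qed
  have RSV: "range S \<subseteq> range V"
  proof
    fix y assume "y \<in> range S"
    then obtain x where y: "y = S x" by blast
    \<comment> \<open>a preimage orthogonal to \<open>N(S)\<close>, hence to \<open>R(T)\<close>, is annihilated by \<open>T\<^sup>*\<close>\<close>
    let ?x = "x - orth_proj (null_space S) x"
    have "u \<bullet> adjoint T ?x = u \<bullet> 0" for u
      using orth_proj_orth[OF NS, of "T u" x] sub(1) adj[of u ?x] by (auto simp: inner_commute)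
    then have "adjoint T ?x = 0" using vector_eq_ldot by blast
    moreover have "S (orth_proj (null_space S) x) = 0" using orth_proj_mem[OF NS] by (simp add: null_space_def)
    ultimately have "V ?x = y" unfolding V_def y by (simp add: linear_diff[OF lS])
    then show "y \<in> range V" by auto
  qed
  note sRV = range_subspace[OF lV]
  have cokernel: "real_ext (range V) UNIV m"
  proof -
    obtain k l where kl: "real_ext (range S \<inter> range V) (null_space T \<inter> range V) k"
      "real_ext (range S + range V) (null_space T + range V) l" "k + l = m"
      using real_vector.finite_ext_modular[OF m sRS sRV] by blast
    have 1: "range S \<inter> range V = range S" using RSV by blast
    have 2: "null_space T \<inter> range V = range S"
    proof
      show "range S \<subseteq> null_space T \<inter> range V" using RSV sub by blast
      show "null_space T \<inter> range V \<subseteq> range S"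
      proof
        fix y assume "y \<in> null_space T \<inter> range V"
        then obtain x where y: "y = S x + adjoint T x" "T y = 0" unfolding V_def null_space_def by auto
        have "T (adjoint T x) = 0" using y TS by (simp add: linear_add[OF lT])
        then have "adjoint T x \<bullet> adjoint T x = 0" using adj[of "adjoint T x" x] by simp
        then show "y \<in> range S" using y by simp
      qed
    qed
    have 3: "range S + range V = range V" using real_vector.set_plus_absorb[OF sRV sRS RSV] by (simp add: add.commute)
    have 4: "null_space T + range V = UNIV"
    proof -
      have "y \<in> null_space T + range V" for y
      proof -
        have "y - orth_proj (null_space T) y \<in> range V"
          using orth_proj_orth[OF NT, of _ y] by (intro onto) (simp add: inner_commute)
        from set_plus_intro[OF orth_proj_mem[OF NT, of y] this] show ?thesis by simp
      qed
      then show ?thesis by blast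
    qed
    have "k = 0" using real_vector.finite_ext_unique[OF sRS kl(1)[unfolded 1 2] finite_ext.refl] .
    then show ?thesis using kl 3 4 by simp
  qed
  show "commensurable_pair (\<lambda>x. S x + adjoint T x) (\<lambda>_. 0)"
    "pair_index (\<lambda>x. S x + adjoint T x) (\<lambda>_. 0) = pair_index S T"
    using fredholmI[OF lV kernel cokernel] ind unfolding V_def by auto
qed

text \<open>The ranges of \<open>T\<close> and \<open>S\<^sup>*\<close> are orthogonal, and \<open>R(S\<^sup>*)\<close> is orthogonal to \<open>N(S)\<close>. So \<open>N(S)\<close> meets the range of \<open>T + S\<^sup>*\<close>
only in \<open>R(T)\<close>; if that range has finite codimension, then \<open>R(T)\<close> has finite codimension in \<open>N(S)\<close>.\<close>

lemma square_zero_pair_commensurable: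
  fixes S :: "'a::{real_inner, complete_space} \<Rightarrow> 'b::{real_inner, complete_space}" and T :: "'b \<Rightarrow> 'a"
  assumes S: "bounded_linear S" and T: "bounded_linear T" and ST: "\<And>y. S (T y) = 0"
    and F: "commensurable_pair (\<lambda>y. T y + adjoint S y) (\<lambda>_. 0)"
  shows "commensurable (null_space S) (range T)"
proof -
  have lS: "linear S" and lT: "linear T" using S T by (auto intro: bounded_linear.linear)
  define V where "V y = T y + adjoint S y" for y
  have lV: "linear V" unfolding V_def
    by (intro linear_compose_add lT bounded_linear.linear[OF adjoint_bounded_linear[OF S]])
  obtain m where m: "real_ext (range V) UNIV m" using fredholmE[OF lV] F unfolding V_def by metis
  note sNS = null_space_subspace[OF lS] and sRV = range_subspace[OF lV] and sRT = range_subspace[OF lT]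
  obtain k where k: "real_ext (range V \<inter> null_space S) (UNIV \<inter> null_space S) k"
    using real_vector.finite_ext_Int[OF m sRV sNS] by blast
  have "range V \<inter> null_space S \<subseteq> range T"
  proof
    fix x assume "x \<in> range V \<inter> null_space S"
    then obtain y where y: "x = T y + adjoint S y" "S x = 0" unfolding V_def null_space_def by auto
    have "S (adjoint S y) = 0" using y ST by (simp add: linear_add[OF lS])
    then have "adjoint S y \<bullet> adjoint S y = 0" using inner_adjoint[OF S, of "adjoint S y" y] by simp
    then show "x \<in> range T" using y by simp
  qed
  moreover have "range T \<subseteq> UNIV \<inter> null_space S" using ST by (auto simp: null_space_def)
  ultimately obtain l where "real_ext (range T) (null_space S) l"
    using real_vector.finite_ext_between[OF k subspace_inter[OF sRV sNS] sRT] by auto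
  then show ?thesis using commensurableI(1)[OF sRT _ finite_ext.refl] by blast
qed

text \<open>The adjoints agree on the orthogonal complement of the range of \<open>f - g\<close>, and this range is finite-dimensional.\<close>

lemma eq_upto_finite_rank_adjoint:
  fixes f g :: "'a::{real_inner, complete_space} \<Rightarrow> 'b::{real_inner, complete_space}"
  assumes f: "bounded_linear f" and g: "bounded_linear g" and "f \<simeq> g"
  shows "adjoint f \<simeq> adjoint g"
proof -
  obtain M n where M: "subspace M" "real_ext M UNIV n" "\<forall>x\<in>M. f x = g x"
    using assms(3) unfolding eq_upto_finite_rank_def by blast
  define h where "h x = f x - g x" for x
  have lh: "linear h" unfolding h_def
    by (intro linear_compose_sub bounded_linear.linear[OF f] bounded_linear.linear[OF g])
  obtain k where "real_ext (h ` M) (range h) k" using finite_ext_image[OF lh M(2,1)] by blast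
  moreover have "h ` M = {0}" using M(3) subspace_0[OF M(1)] unfolding h_def by force
  ultimately have Y: "real_ext {0} (range h) k" by simp
  note cl = finite_dim_closed[OF Y] range_subspace[OF lh]
  let ?P = "orth_proj (range h)"
  obtain l where "real_ext (?P -` {0}) (?P -` range h) l"
    using finite_ext_vimage[OF orth_proj_linear[OF cl] Y] by auto
  moreover have "?P -` range h = UNIV" using orth_proj_mem[OF cl] by blast
  moreover have "adjoint f y = adjoint g y" if "y \<in> ?P -` {0}" for y
  proof -
    have "y \<bullet> h x = 0" for x using that orth_proj_eq_0_iff[OF cl, of y] by auto
    then have "x \<bullet> adjoint f y = x \<bullet> adjoint g y" for x
      unfolding inner_adjoint[OF f, symmetric] inner_adjoint[OF g, symmetric]
      by (simp add: h_def inner_diff_right inner_commute)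
    then show ?thesis using vector_eq_ldot by blast
  qed
  moreover have "subspace (?P -` {0})"
    using linear_subspace_vimage[OF orth_proj_linear[OF cl], of "{0}"] by simp
  ultimately show ?thesis unfolding eq_upto_finite_rank_def by auto
qed

lemma eq_upto_finite_rank_remove_finite_dim:
  fixes K :: "'a::real_vector \<Rightarrow> 'b::{real_inner, complete_space}"
  assumes K: "linear K" and Y: "real_ext {0} Y n"
  shows "K \<simeq> (\<lambda>x. K x - orth_proj Y (K x))"
proof -
  have sY: "subspace Y" using real_vector.finite_ext_subspace[OF Y] by simp
  note cl = finite_dim_closed[OF Y] sY
  define f where "f x = orth_proj Y (K x)" for x
  have lf: "linear f" unfolding f_def using linear_compose[OF K orth_proj_linear[OF cl]] by (simp add: o_def)
  obtain l where "real_ext (f -` {0}) (f -` Y) l" using finite_ext_vimage[OF lf Y] by auto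
  moreover have "f -` Y = UNIV" unfolding f_def using orth_proj_mem[OF cl] by blast
  moreover have "subspace (f -` {0})"
    using linear_subspace_vimage[OF lf, of "{0}"] by simp
  moreover have "\<forall>x\<in>f -` {0}. K x = K x - orth_proj Y (K x)" unfolding f_def by auto
  ultimately show ?thesis unfolding eq_upto_finite_rank_def by auto
qed

lemma bounded_linear_remove_finite_dim:
  fixes K :: "'a::real_normed_vector \<Rightarrow> 'b::{real_inner, complete_space}"
  assumes K: "bounded_linear K" and Y: "real_ext {0} Y n"
  shows "bounded_linear (\<lambda>x. K x - orth_proj Y (K x))"
proof -
  have sY: "subspace Y" using real_vector.finite_ext_subspace[OF Y] by simp
  show ?thesis
    by (intro bounded_linear_sub K bounded_linear_compose[OF orth_proj_bounded_linear[OF finite_dim_closed[OF Y] sY]])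
qed

text \<open>First make \<open>S\<close> vanish on \<open>R(T)\<close> by composing it with the projection along the finite-dimensional range of \<open>S T\<close>; then
\<open>T\<close> composed with the new \<open>S'\<close> still has finite rank, and the same correction is made on \<open>T\<close>. It does not spoil
\<open>S' T = 0\<close>, because the correction takes values in \<open>R(T)\<close>, where \<open>S'\<close> vanishes.\<close>

lemma square_zero_correction:
  fixes S :: "'a::{real_inner, complete_space} \<Rightarrow> 'b::{real_inner, complete_space}" and T :: "'b \<Rightarrow> 'a"
  assumes S: "bounded_linear S" and T: "bounded_linear T"
    and ST: "real_ext {0} (range (S \<circ> T)) p" and TS: "real_ext {0} (range (T \<circ> S)) q"
  shows "\<exists>S' T'. bounded_linear S' \<and> bounded_linear T' \<and> S \<simeq> S' \<and> T \<simeq> T' \<and>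
    (\<forall>y. S' (T' y) = 0) \<and> (\<forall>x. T' (S' x) = 0)"
proof -
  have lS: "linear S" and lT: "linear T" using S T by (auto intro: bounded_linear.linear)
  let ?Y = "range (S \<circ> T)"
  have cY: "closed ?Y" "subspace ?Y" using finite_dim_closed[OF ST] real_vector.finite_ext_subspace[OF ST] by auto
  define S' where "S' x = S x - orth_proj ?Y (S x)" for x
  have S': "bounded_linear S'" "S \<simeq> S'" unfolding S'_def
    using bounded_linear_remove_finite_dim[OF S ST] eq_upto_finite_rank_remove_finite_dim[OF lS ST] by auto
  have lS': "linear S'" using S'(1) by (rule bounded_linear.linear)
  have S'T: "S' (T y) = 0" for y using orth_proj_id[OF cY, of "S (T y)"] unfolding S'_def by auto
  have TS': "\<exists>r. real_ext {0} (range (T \<circ> S')) r"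
  proof -
    have l: "linear (T \<circ> S)" "linear (T \<circ> S')" using linear_compose lS lS' lT by blast+
    have "T \<circ> S \<simeq> T \<circ> S'" using S'(2) unfolding eq_upto_finite_rank_def by (metis comp_apply)
    note c = relative_dim_kernel_plus_range(2)[OF l this]
    obtain b where b: "subspace (range (T \<circ> S))" "subspace (range (T \<circ> S'))"
      "real_ext (range (T \<circ> S) \<inter> range (T \<circ> S')) (range (T \<circ> S')) b"
      using commensurableE[OF c] by metis
    have sI: "subspace (range (T \<circ> S) \<inter> range (T \<circ> S'))" using subspace_inter[OF b(1,2)] .
    obtain k where "real_ext {0} (range (T \<circ> S) \<inter> range (T \<circ> S')) k"
      using real_vector.finite_ext_between[OF TS subspace_single_0 sI] subspace_0[OF sI] by auto
    from finite_ext_trans[OF b(3) this] show ?thesis by blast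
  qed
  then obtain r where r: "real_ext {0} (range (T \<circ> S')) r" by blast
  let ?Z = "range (T \<circ> S')"
  have cZ: "closed ?Z" "subspace ?Z" using finite_dim_closed[OF r] real_vector.finite_ext_subspace[OF r] by auto
  define T' where "T' y = T y - orth_proj ?Z (T y)" for y
  have T': "bounded_linear T'" "T \<simeq> T'" unfolding T'_def
    using bounded_linear_remove_finite_dim[OF T r] eq_upto_finite_rank_remove_finite_dim[OF lT r] by auto
  have "T' (S' x) = 0" for x using orth_proj_id[OF cZ, of "T (S' x)"] unfolding T'_def by auto
  moreover have "S' (T' y) = 0" for y
  proof -
    obtain x where "orth_proj ?Z (T y) = T (S' x)" using orth_proj_mem[OF cZ, of "T y"] by auto
    then show ?thesis unfolding T'_def by (simp add: linear_diff[OF lS'] S'T)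
  qed
  ultimately show ?thesis using S' T' by blast
qed

lemma commensurable_pair_finite_rank_product:
  fixes S :: "'a::real_vector \<Rightarrow> 'b::real_vector"
  assumes S: "linear S" and fp: "commensurable_pair S T"
  shows "\<exists>k. real_ext {0} (range (S \<circ> T)) k"
proof -
  obtain n where n: "subspace (range T)" "real_ext (null_space S \<inter> range T) (range T) n"
    using fp commensurableE unfolding commensurable_pair_def by metis
  have sI: "subspace (null_space S \<inter> range T)" using subspace_inter[OF null_space_subspace[OF S] n(1)] .
  obtain k where "real_ext (S ` (null_space S \<inter> range T)) (S ` range T) k"
    using finite_ext_image[OF S n(2) sI] by blast
  moreover have "S ` (null_space S \<inter> range T) = {0}"
    using subspace_0[OF sI] linear_0[OF S] by (auto simp: null_space_def image_iff) metis
  ultimately show ?thesis by (metis image_comp)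
qed

section \<open>Compact perturbations over the reals\<close>

text \<open>\<open>(S\<^sub>0, T\<^sub>0)\<close> and \<open>(S\<^sub>2, T\<^sub>2)\<close> below are the corrections of \<open>(S, T)\<close> and \<open>(S\<^sub>1, T\<^sub>1)\<close> with zero products, and \<open>L\<close> and \<open>L'\<close> are
the small parts of \<open>K\<close> and \<open>K'\<close>. Modulo finite rank, \<open>S\<^sub>2 + T\<^sub>2\<^sup>*\<close> is \<open>(S\<^sub>0 + T\<^sub>0\<^sup>*) + (L + L'\<^sup>*)\<close>. The operator \<open>T\<^sub>2 + S\<^sub>2\<^sup>*\<close>
has to be treated as well, since both are needed to recognize the pair \<open>(S\<^sub>2, T\<^sub>2)\<close> as Fredholm.\<close>

theorem compact_perturbation_real:
  fixes S K :: "'a::{real_inner, complete_space} \<Rightarrow> 'b::{real_inner, complete_space}" and T K' :: "'b \<Rightarrow> 'a"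
  assumes S: "bounded_linear S" and T: "bounded_linear T" and K: "bounded_linear K" and K': "bounded_linear K'"
    and fp: "commensurable_pair S T"
    and cK: "compact (closure (K ` cball 0 1))" and cK': "compact (closure (K' ` cball 0 1))"
    and S1: "S1 = (\<lambda>x. S x + K x)" and T1: "T1 = (\<lambda>y. T y + K' y)"
    and fr: "real_ext {0} (range (S1 \<circ> T1)) p" "real_ext {0} (range (T1 \<circ> S1)) q"
  shows "commensurable_pair S1 T1" "pair_index S1 T1 = pair_index S T"
proof -
  note lin = bounded_linear.linear
  have bS1: "bounded_linear S1" and bT1: "bounded_linear T1"
    unfolding S1 T1 by (intro bounded_linear_add S T K K')+
  obtain p0 where p0: "real_ext {0} (range (S \<circ> T)) p0"
    using commensurable_pair_finite_rank_product[OF lin[OF S] fp] by blast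
  obtain q0 where q0: "real_ext {0} (range (T \<circ> S)) q0"
    using commensurable_pair_finite_rank_product[OF lin[OF T]] fp commensurable_pair_swap(1) by blast
  obtain S0 T0 where 0: "bounded_linear S0" "bounded_linear T0" "S \<simeq> S0" "T \<simeq> T0"
    "\<And>y. S0 (T0 y) = 0" "\<And>x. T0 (S0 x) = 0"
    using square_zero_correction[OF S T p0 q0] by metis
  obtain S2 T2 where 2: "bounded_linear S2" "bounded_linear T2" "S1 \<simeq> S2" "T1 \<simeq> T2"
    "\<And>y. S2 (T2 y) = 0" "\<And>x. T2 (S2 x) = 0"
    using square_zero_correction[OF bS1 bT1 fr] by metis
  note fp0 = commensurable_pair_cong[OF lin[OF S] lin[OF 0(1)] lin[OF T] lin[OF 0(2)] 0(3,4) fp]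
  have fp0': "commensurable_pair T0 S0" using fp0(1) commensurable_pair_swap(1) by blast
  let ?V = "\<lambda>x. S0 x + adjoint T0 x" and ?V' = "\<lambda>y. T0 y + adjoint S0 y"
  let ?V2 = "\<lambda>x. S2 x + adjoint T2 x" and ?V2' = "\<lambda>y. T2 y + adjoint S2 y"
  note V = square_zero_pair_fredholm[OF 0(1,2,5,6) fp0(1)]
  note V' = square_zero_pair_fredholm[OF 0(2,1,6,5) fp0']
  have bV: "bounded_linear ?V" and bV': "bounded_linear ?V'"
    and bV2: "bounded_linear ?V2" and bV2': "bounded_linear ?V2'"
    by (intro bounded_linear_add adjoint_bounded_linear 0 2)+
  obtain e where e: "e > 0" "\<And>G. bounded_linear G \<Longrightarrow> (\<And>x. norm (G x) \<le> e * norm x) \<Longrightarrow>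
      commensurable_pair (\<lambda>x. ?V x + G x) (\<lambda>_. 0) \<and> pair_index (\<lambda>x. ?V x + G x) (\<lambda>_. 0) = pair_index ?V (\<lambda>_. 0)"
    using fredholm_small_perturbation[OF bV V(1)] by blast
  obtain e' where e': "e' > 0" "\<And>G. bounded_linear G \<Longrightarrow> (\<And>x. norm (G x) \<le> e' * norm x) \<Longrightarrow>
      commensurable_pair (\<lambda>x. ?V' x + G x) (\<lambda>_. 0) \<and> pair_index (\<lambda>x. ?V' x + G x) (\<lambda>_. 0) = pair_index ?V' (\<lambda>_. 0)"
    using fredholm_small_perturbation[OF bV' V'(1)] by blast
  \<comment> \<open>each of \<open>L + L'\<^sup>*\<close> and \<open>L' + L\<^sup>*\<close> has two summands of norm at most \<open>d\<close>\<close>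
  define d where "d = min e e' / 2"
  have d: "d > 0" "2 * d \<le> e" "2 * d \<le> e'" unfolding d_def using e(1) e'(1) by auto
  obtain Y n where Y: "real_ext {0} Y n" "\<And>x. norm (K x - orth_proj Y (K x)) \<le> d * norm x"
    using compact_finite_rank_approx[OF lin[OF K] cK d(1)] by blast
  obtain Y' n' where Y': "real_ext {0} Y' n'" "\<And>x. norm (K' x - orth_proj Y' (K' x)) \<le> d * norm x"
    using compact_finite_rank_approx[OF lin[OF K'] cK' d(1)] by blast
  define L where "L x = K x - orth_proj Y (K x)" for x
  define L' where "L' x = K' x - orth_proj Y' (K' x)" for x
  have L: "bounded_linear L" "K \<simeq> L" "\<And>x. norm (L x) \<le> d * norm x" unfolding L_def
    using bounded_linear_remove_finite_dim[OF K Y(1)] eq_upto_finite_rank_remove_finite_dim[OF lin[OF K] Y(1)] Y(2) by auto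
  have L': "bounded_linear L'" "K' \<simeq> L'" "\<And>x. norm (L' x) \<le> d * norm x" unfolding L'_def
    using bounded_linear_remove_finite_dim[OF K' Y'(1)] eq_upto_finite_rank_remove_finite_dim[OF lin[OF K'] Y'(1)] Y'(2) by auto
  have S2: "S2 \<simeq> (\<lambda>x. S0 x + L x)"
    using eq_upto_finite_rank_trans[OF eq_upto_finite_rank_sym[OF 2(3)]] eq_upto_finite_rank_add[OF 0(3) L(2)] unfolding S1 by blast
  have T2: "T2 \<simeq> (\<lambda>x. T0 x + L' x)"
    using eq_upto_finite_rank_trans[OF eq_upto_finite_rank_sym[OF 2(4)]] eq_upto_finite_rank_add[OF 0(4) L'(2)] unfolding T1 by blast
  have aS2: "adjoint S2 \<simeq> (\<lambda>y. adjoint S0 y + adjoint L y)"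
    using eq_upto_finite_rank_adjoint[OF 2(1) bounded_linear_add[OF 0(1) L(1)] S2] adjoint_add[OF 0(1) L(1)] by simp
  have aT2: "adjoint T2 \<simeq> (\<lambda>y. adjoint T0 y + adjoint L' y)"
    using eq_upto_finite_rank_adjoint[OF 2(2) bounded_linear_add[OF 0(2) L'(1)] T2] adjoint_add[OF 0(2) L'(1)] by simp
  let ?G = "\<lambda>x. L x + adjoint L' x" and ?G' = "\<lambda>y. L' y + adjoint L y"
  have bG: "bounded_linear ?G" and bG': "bounded_linear ?G'"
    by (intro bounded_linear_add adjoint_bounded_linear L L')+
  have G: "norm (?G x) \<le> e * norm x" for x
  proof -
    have "norm (?G x) \<le> d * norm x + d * norm x"
      using norm_triangle_ineq[of "L x" "adjoint L' x"] L(3)[of x] adjoint_norm_le[OF L'(1,3), of x] d(1) by linarith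
    also have "\<dots> = (2 * d) * norm x" by simp
    also have "\<dots> \<le> e * norm x" using d(2) by (rule mult_right_mono) simp
    finally show ?thesis .
  qed
  have G': "norm (?G' x) \<le> e' * norm x" for x
  proof -
    have "norm (?G' x) \<le> d * norm x + d * norm x"
      using norm_triangle_ineq[of "L' x" "adjoint L x"] L'(3)[of x] adjoint_norm_le[OF L(1,3), of x] d(1) by linarith
    also have "\<dots> = (2 * d) * norm x" by simp
    also have "\<dots> \<le> e' * norm x" using d(3) by (rule mult_right_mono) simp
    finally show ?thesis .
  qed
  note pV = e(2)[OF bG G] and pV' = e'(2)[OF bG' G']
  have "?V2 \<simeq> (\<lambda>x. (S0 x + L x) + (adjoint T0 x + adjoint L' x))" by (rule eq_upto_finite_rank_add[OF S2 aT2])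
  from eq_upto_finite_rank_sym[OF this] have eq: "(\<lambda>x. ?V x + ?G x) \<simeq> ?V2" by (simp add: ac_simps)
  have "?V2' \<simeq> (\<lambda>x. (T0 x + L' x) + (adjoint S0 x + adjoint L x))" by (rule eq_upto_finite_rank_add[OF T2 aS2])
  from eq_upto_finite_rank_sym[OF this] have eq': "(\<lambda>x. ?V' x + ?G' x) \<simeq> ?V2'" by (simp add: ac_simps)
  note V2 = commensurable_pair_cong_left[OF lin[OF bounded_linear_add[OF bV bG]] lin[OF bV2] eq conjunct1[OF pV]]
  note V2' = commensurable_pair_cong_left[OF lin[OF bounded_linear_add[OF bV' bG']] lin[OF bV2'] eq' conjunct1[OF pV']]
  have fp2: "commensurable_pair S2 T2"
    unfolding commensurable_pair_def
    using square_zero_pair_commensurable[OF 2(1,2,5) V2'(1)] square_zero_pair_commensurable[OF 2(2,1,6) V2(1)] by blast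
  note i2 = square_zero_pair_fredholm(2)[OF 2(1,2,5,6) fp2]
  have i: "pair_index S2 T2 = pair_index S T" using i2 V2(2) pV V(2) fp0(2) by simp
  note fin = commensurable_pair_cong[OF lin[OF 2(1)] lin[OF bS1] lin[OF 2(2)] lin[OF bT1] eq_upto_finite_rank_sym[OF 2(3)] eq_upto_finite_rank_sym[OF 2(4)] fp2]
  show "commensurable_pair S1 T1" using fin(1) .
  show "pair_index S1 T1 = pair_index S T" using fin(2) i by simp
qed

section \<open>From the reals to the scalar field\<close>

lemma rc_field_real_dim: "\<exists>m>0. real_ext {0} (UNIV :: 'k::rc_field set) m"
proof -
  obtain i :: 'k where i: "\<And>x. \<exists>a b. x = scaleR a 1 + scaleR b i" using two_generators by blast
  have "x \<in> span {1, i}" for x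
  proof -
    obtain a b where "x = scaleR a 1 + scaleR b i" using i by blast
    then show ?thesis by (simp add: span_add span_scale span_base)
  qed
  then have "span {1, i} = UNIV" by blast
  then obtain m where m: "real_ext {0} (UNIV :: 'k set) m"
    using real_vector.finite_ext_span[of "{1, i}"] by auto
  have "m \<noteq> 0"
  proof
    assume "m = 0"
    then have "(UNIV :: 'k set) = {0}" using m by (simp only: finite_ext_0)
    then have "(1::'k) = 0" by blast
    then show False by simp
  qed
  then show ?thesis using m by auto
qed

text \<open>Every Hilbert space is an instance. Compatibility with the real scalar multiplication is what relates
dimensions over the two fields.\<close>

locale rc_vector_space = vector_space scale
  for scale :: "'k::rc_field \<Rightarrow> 'a::real_vector \<Rightarrow> 'a" +
  assumes scale_of_real: "scale (of_real r) x = r *\<^sub>R x"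
begin

lemma real_subspace: "subspace V \<Longrightarrow> Real_Vector_Spaces.subspace V"
  using subspace_scale[of V _ "of_real _"] 
  by (auto simp: real_vector.subspace_def scale_of_real intro: subspace_0 subspace_add)

text \<open>The line spanned by \<open>b\<close> is the injective image of the scalar field, and it meets \<open>V\<close> only in 0.\<close>

lemma real_ext_adjoin:
  assumes V: "subspace V" and b: "b \<notin> V" and m: "real_ext {0} (UNIV :: 'k set) m"
  shows "real_ext V (adjoin scale V b) m"
proof -
  define f where "f c = scale c b" for c
  have f: "Real_Vector_Spaces.linear f"
  proof (rule linearI)
    show "f (c + d) = f c + f d" for c d unfolding f_def by (rule scale_left_distrib)
    show "f (r *\<^sub>R c) = r *\<^sub>R f c" for r c
      unfolding f_def scale_of_real[symmetric] by (simp add: scaleR_conv_of_real)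
  qed
  have fV: "c = 0" if "f c \<in> V" for c
  proof (rule ccontr)
    assume "c \<noteq> 0"
    then have "scale (inverse c) (f c) = b" unfolding f_def by simp
    then show False using subspace_scale[OF V that, of "inverse c"] b by simp
  qed
  have f0: "f 0 = 0" unfolding f_def by simp
  have N: "null_space f = {0}" using fV subspace_0[OF V] f0 by (auto simp: null_space_def)
  obtain k l where kl: "real_ext (f ` {0}) (range f) k" "real_ext ({0} \<inter> null_space f) (UNIV \<inter> null_space f) l" "k + l = m"
    using finite_ext_image[OF f m] by auto
  have "l = 0" using real_vector.finite_ext_unique[OF real_vector.subspace_single_0, of "{0}" l 0] kl(2) N finite_ext.refl by auto
  then have rf: "real_ext {0} (range f) m" using kl f0 by simp
  have rV: "Real_Vector_Spaces.subspace V" using real_subspace[OF V] .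
  obtain k' l' where kl': "real_ext ({0} \<inter> V) (range f \<inter> V) k'" "real_ext ({0} + V) (range f + V) l'" "k' + l' = m"
    using real_vector.finite_ext_modular[OF rf real_vector.subspace_single_0 rV] by blast
  have e: "{0} \<inter> V = {0}" "range f \<inter> V = {0}"
    using fV f0 subspace_0[OF V] by (auto simp: image_iff)
  have "k' = 0" using real_vector.finite_ext_unique[OF real_vector.subspace_single_0 kl'(1)[unfolded e] finite_ext.refl] .
  moreover have "{0} + V = V" by (simp add: set_plus_def)
  moreover have "range f + V = adjoin scale V b"
    unfolding set_plus_def adjoin_def f_def by (auto simp: add.commute)
  ultimately show ?thesis using kl' by simp
qed

lemma finite_ext_imp_real_ext:
  assumes "finite_ext scale W V n" and W: "subspace W" and m: "real_ext {0} (UNIV :: 'k set) m"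
  shows "real_ext W V (m * n)"
  using assms(1)
proof (induction rule: finite_ext.induct)
  case refl
  show ?case by (simp add: finite_ext.refl)
next
  case (step V n b)
  from finite_ext_trans[OF real_ext_adjoin[OF finite_ext_subspace[OF step(1) W] step(2) m] step(3)]
  show ?case by (simp add: add.commute)
qed

text \<open>Adjoining a vector over the scalar field uses up \<open>m > 0\<close> of the finitely many real dimensions, so the process stops.\<close>

lemma real_ext_imp_finite_ext:
  assumes "real_ext W V n" "subspace W" "subspace V"
  shows "\<exists>k. finite_ext scale W V k"
proof -
  obtain m where m: "m > 0" "real_ext {0} (UNIV :: 'k set) m" using rc_field_real_dim by blast
  show ?thesis
    using assms(1,2)
  proof (induction n arbitrary: W rule: less_induct)
    case (less n)
    have sub: "W \<subseteq> V" using real_vector.finite_ext_subset[OF less(2)] .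
    show ?case
    proof (cases "W = V")
      case True
      then show ?thesis using finite_ext.refl by blast
    next
      case False
      then obtain b where b: "b \<in> V" "b \<notin> W" using sub by blast
      let ?W = "adjoin scale W b"
      have sW: "subspace ?W" using subspace_adjoin[OF less(3)] .
      have subs: "W \<subseteq> ?W" "?W \<subseteq> V" using adjoin_superset adjoin_subset[OF assms(3) sub b(1)] by auto
      obtain k l where kl: "real_ext W ?W k" "real_ext ?W V l" "k + l = n"
        using real_vector.finite_ext_between[OF less(2) real_subspace[OF less(3)] real_subspace[OF sW] subs] by blast
      have "k = m"
        using real_vector.finite_ext_unique[OF real_subspace[OF less(3)] kl(1) real_ext_adjoin[OF less(3) b(2) m(2)]] .
      then obtain k' where "finite_ext scale ?W V k'" using less(1)[OF _ kl(2) sW] kl(3) m(1) by auto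
      from finite_ext_trans[OF this finite_ext.step[OF finite_ext.refl b(2)]] show ?thesis by blast
    qed
  qed
qed

lemma quotient_finite_dim_real:
  assumes "subspace W" "subspace V" "W \<subseteq> V"
  shows "quotient_finite_dim scaleR V W \<longleftrightarrow> quotient_finite_dim scale V W"
proof -
  obtain m where m: "real_ext {0} (UNIV :: 'k set) m" using rc_field_real_dim by blast
  show ?thesis
    unfolding quotient_finite_dim_iff[OF assms]
      real_vector.quotient_finite_dim_iff[OF real_subspace[OF assms(1)] real_subspace[OF assms(2)] assms(3)]
    using finite_ext_imp_real_ext[OF _ assms(1) m] real_ext_imp_finite_ext[OF _ assms(1,2)] by blast
qed

lemma quotient_dim_real:
  assumes W: "subspace W" and V: "subspace V" "W \<subseteq> V" and "quotient_finite_dim scale V W"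
    and m: "real_ext {0} (UNIV :: 'k set) m"
  shows "quotient_dim scaleR V W = m * quotient_dim scale V W"
proof -
  obtain n where n: "finite_ext scale W V n" using assms(4) quotient_finite_dim_iff[OF W V] by blast
  show ?thesis
    using quotient_dim_eq[OF W n] real_vector.quotient_dim_eq[OF real_subspace[OF W] finite_ext_imp_real_ext[OF n W m]] by simp
qed

end

lemma hilbert_space_rc_vector_space: "hilbert_space s ip \<Longrightarrow> rc_vector_space s"
  unfolding hilbert_space_def rc_vector_space_def hilbert_space_axioms_def rc_vector_space_axioms_def by blast

lemma linear_imp_real_linear:
  assumes "rc_vector_space s1" "rc_vector_space s2" "Vector_Spaces.linear s1 s2 f"
  shows "linear f"
proof (rule linearI)
  show "f (x + y) = f x + f y" for x y using assms(3) unfolding Vector_Spaces.linear_iff by blast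
  show "f (r *\<^sub>R x) = r *\<^sub>R f x" for r x
    using assms(3) rc_vector_space.scale_of_real[OF assms(1), of r x] rc_vector_space.scale_of_real[OF assms(2), of r "f x"]
    unfolding Vector_Spaces.linear_iff by metis
qed

lemma linear_subspaces:
  assumes "Vector_Spaces.linear s1 s2 f"
  shows "module.subspace s1 (null_space f)" "module.subspace s2 (range f)"
proof -
  interpret Vector_Spaces.linear s1 s2 f by fact
  show "module.subspace s1 (null_space f)" unfolding null_space_def by (rule subspace_kernel)
  show "module.subspace s2 (range f)" by (rule subspace_image) (rule vs1.subspace_UNIV)
qed

lemma commensurable_pair_iff_fredholm_pair:
  assumes s1: "rc_vector_space s1" and s2: "rc_vector_space s2"
    and S: "Vector_Spaces.linear s1 s2 S" and T: "Vector_Spaces.linear s2 s1 T"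
    and b: "bounded_linear S" "bounded_linear T"
  shows "commensurable_pair S T \<longleftrightarrow> fredholm_pair s1 s2 S T"
    and "real_ext {0} (UNIV :: 'k::rc_field set) m \<Longrightarrow> fredholm_pair s1 s2 S T \<Longrightarrow>
      pair_index S T = int m * fredholm_index (s1 :: 'k \<Rightarrow> _) s2 S T"
proof -
  interpret h1: rc_vector_space s1 by fact
  interpret h2: rc_vector_space s2 by fact
  note N1 = linear_subspaces(1)[OF S] and R2 = linear_subspaces(2)[OF S]
  note N2 = linear_subspaces(1)[OF T] and R1 = linear_subspaces(2)[OF T]
  note I1 = h1.subspace_inter[OF N1 R1] and I2 = h2.subspace_inter[OF N2 R2]
  show "commensurable_pair S T \<longleftrightarrow> fredholm_pair s1 s2 S T"
    unfolding commensurable_pair_def commensurable_def fredholm_pair_def bounded_operators_def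
    using S T b h1.real_subspace[OF N1] h1.real_subspace[OF R1] h2.real_subspace[OF N2] h2.real_subspace[OF R2]
    by (simp add: h1.quotient_finite_dim_real[OF I1 N1] h1.quotient_finite_dim_real[OF I1 R1]
      h2.quotient_finite_dim_real[OF I2 N2] h2.quotient_finite_dim_real[OF I2 R2])
  assume m: "real_ext {0} (UNIV :: 'k set) m" and f: "fredholm_pair s1 s2 S T"
  show "pair_index S T = int m * fredholm_index s1 s2 S T"
    using f unfolding fredholm_index_def fredholm_pair_def
    by (simp add: h1.quotient_dim_real[OF I1 N1 _ _ m] h1.quotient_dim_real[OF I1 R1 _ _ m]
      h2.quotient_dim_real[OF I2 N2 _ _ m] h2.quotient_dim_real[OF I2 R2 _ _ m] algebra_simps)
qed

lemma compact_operator_bounded_linear: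
  assumes "rc_vector_space s1" "rc_vector_space s2" and K: "compact_operator s1 s2 K"
  shows "bounded_linear K" "compact (closure (K ` cball 0 1))"
proof -
  have lK: "linear K"
    using linear_imp_real_linear[OF assms(1,2)] K unfolding compact_operator_def by blast
  show c: "compact (closure (K ` cball 0 1))" using K unfolding compact_operator_def by simp
  then have "bounded (K ` cball 0 1)" using bounded_subset[OF compact_imp_bounded closure_subset] by blast
  then obtain B where "\<forall>y\<in>K ` cball 0 1. norm y \<le> B" unfolding bounded_iff by blast
  then have B: "norm (K x) \<le> B" if "norm x \<le> 1" for x using that by auto
  show "bounded_linear K"
  proof (rule bounded_linear_intro[of _ B])
    fix x
    show "norm (K x) \<le> norm x * B"
    proof (cases "x = 0")
      case False
      then have "x = norm x *\<^sub>R (inverse (norm x) *\<^sub>R x)" by simp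
      then have "norm (K x) = norm x * norm (K (inverse (norm x) *\<^sub>R x))"
        by (metis linear_scale[OF lK] norm_scaleR abs_norm_cancel)
      also have "\<dots> \<le> norm x * B" using False by (intro mult_left_mono B) auto
      finally show ?thesis .
    qed (simp add: linear_0[OF lK])
  qed (simp_all add: linear_add[OF lK] linear_scale[OF lK])
qed

lemma finite_dimensional_real_ext:
  assumes "rc_vector_space s" "finite_dimensional s V"
  shows "\<exists>n. real_ext {0} V n"
proof -
  interpret rc_vector_space s by fact
  obtain B where "finite B" "span B = V" using assms(2) unfolding finite_dimensional_def by blast
  then obtain n where n: "finite_ext s {0} V n" using finite_ext_span by blast
  obtain m where "real_ext {0} (UNIV :: 'a set) m" using rc_field_real_dim by blast
  from finite_ext_imp_real_ext[OF n subspace_single_0 this] show ?thesis by blast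
qed

section \<open>Compact perturbations of Fredholm pairs\<close>

theorem theorem5p2:
  fixes scale1 :: "'k::rc_field \<Rightarrow> 'a::{real_inner, complete_space} \<Rightarrow> 'a"
    and scale2 :: "'k \<Rightarrow> 'b::{real_inner, complete_space} \<Rightarrow> 'b"
    and ip1 :: "'a \<Rightarrow> 'a \<Rightarrow> 'k"
    and ip2 :: "'b \<Rightarrow> 'b \<Rightarrow> 'k"
    and S K S1 :: "'a \<Rightarrow> 'b"
    and T K' T1 :: "'b \<Rightarrow> 'a"
  assumes "hilbert_space scale1 ip1"
    and "hilbert_space scale2 ip2"
    and "fredholm_pair scale1 scale2 S T"
    and "compact_operator scale1 scale2 K"
    and "compact_operator scale2 scale1 K'"
    and "S1 = (\<lambda>x. S x + K x)"
    and "T1 = (\<lambda>y. T y + K' y)"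
    and "finite_dimensional scale1 (range (T1 \<circ> S1))"
    and "finite_dimensional scale2 (range (S1 \<circ> T1))"
  shows "fredholm_pair scale1 scale2 S1 T1 \<and>
         fredholm_index scale1 scale2 S T = fredholm_index scale1 scale2 S1 T1"
proof -
  note s1 = hilbert_space_rc_vector_space[OF assms(1)] and s2 = hilbert_space_rc_vector_space[OF assms(2)]
  have S: "Vector_Spaces.linear scale1 scale2 S" "bounded_linear S"
    and T: "Vector_Spaces.linear scale2 scale1 T" "bounded_linear T"
    using assms(3) unfolding fredholm_pair_def bounded_operators_def by auto
  have K: "Vector_Spaces.linear scale1 scale2 K" and K': "Vector_Spaces.linear scale2 scale1 K'"
    using assms(4,5) unfolding compact_operator_def by auto
  note bK = compact_operator_bounded_linear[OF s1 s2 assms(4)]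
  note bK' = compact_operator_bounded_linear[OF s2 s1 assms(5)]
  interpret v1: vector_space scale1 using s1 unfolding rc_vector_space_def by blast
  interpret v2: vector_space scale2 using s2 unfolding rc_vector_space_def by blast
  have S1: "Vector_Spaces.linear scale1 scale2 S1" "bounded_linear S1"
    using S(1) K bounded_linear_add[OF S(2) bK(1)] unfolding assms(6) Vector_Spaces.linear_iff
    by (auto simp: v2.scale_right_distrib ac_simps)
  have T1: "Vector_Spaces.linear scale2 scale1 T1" "bounded_linear T1"
    using T(1) K' bounded_linear_add[OF T(2) bK'(1)] unfolding assms(7) Vector_Spaces.linear_iff
    by (auto simp: v1.scale_right_distrib ac_simps)
  obtain m where m: "m > 0" "real_ext {0} (UNIV :: 'k set) m" using rc_field_real_dim by blast
  obtain p q where pq: "real_ext {0} (range (S1 \<circ> T1)) p" "real_ext {0} (range (T1 \<circ> S1)) q"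
    using finite_dimensional_real_ext[OF s2 assms(9)] finite_dimensional_real_ext[OF s1 assms(8)] by blast
  note pair = commensurable_pair_iff_fredholm_pair[OF s1 s2 S(1) T(1) S(2) T(2)]
  note pair1 = commensurable_pair_iff_fredholm_pair[OF s1 s2 S1(1) T1(1) S1(2) T1(2)]
  have "commensurable_pair S T" using pair(1) assms(3) by blast
  note stab = compact_perturbation_real[OF S(2) T(2) bK(1) bK'(1) this bK(2) bK'(2) assms(6,7) pq]
  have fp1: "fredholm_pair scale1 scale2 S1 T1" using stab(1) pair1(1) by blast
  have "int m * fredholm_index scale1 scale2 S T = int m * fredholm_index scale1 scale2 S1 T1"
    using stab(2) pair(2)[OF m(2) assms(3)] pair1(2)[OF m(2) fp1] by metis
  then have "fredholm_index scale1 scale2 S T = fredholm_index scale1 scale2 S1 T1"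
    using m(1) by (metis mult_left_cancel of_nat_0_less_iff less_irrefl)
  then show ?thesis using fp1 by simp
qed

end
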